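(* The full monoidal subcategory of the category of finite $\mathbb{B}$-semimodules whose objects are the finite projective $\mathbb{B}$-semimodules is a rigid symmetric monoidal category.
   Context: $\mathbb{B}=\{0,1\mid 1+1=1\}$ is the Boolean semiring. A $\mathbb{B}$-semimodule is a commutative monoid $(M,+,0)$ with $a+a=a$ for all $a\in M$; morphisms preserve $+$ and $0$. The category of finite $\mathbb{B}$-semimodules is symmetric monoidal under $\otimes$, where $M\otimes N$ is the $\mathbb{B}$-semimodule universal for maps $M\times N\to K$ that are semimodule homomorphisms in each variable; the unit object is $\mathbb{B}$. A $\mathbb{B}$-semimodule $P$ is projective if for every surjective homomorphism $M\to N$ the induced map $\mathrm{Hom}(P,M)\to\mathrm{Hom}(P,N)$ is surjective. A symmetric monoidal category is rigid if every object $X$ has a dual $X^{\ast}$ with morphisms $\mathrm{ev}_X:X^{\ast}\otimes X\to\mathbf{1}$ and $\mathrm{coev}_X:\mathbf{1}\to X\otimes X^{\ast}$ such that $(\mathrm{id}_X\otimes\mathrm{ev}_X)\circ(\mathrm{coev}_X\otimes\mathrm{id}_X)=\mathrm{id}_X$ and $(\mathrm{ev}_X\otimes\mathrm{id}_{X^{\ast}})\circ(\mathrm{id}_{X^{\ast}}\otimes\mathrm{coev}_X)=\mathrm{id}_{X^{\ast}}$. Here the dual of $P$ is $P^{\ast}=\mathrm{Hom}(P,\mathbb{B})$ with $\mathrm{ev}_P(f\otimes y)=f(y)$. *)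

theory Defs
  imports "HOL-Algebra.FiniteProduct" "HOL-Library.FSet"
begin

section \<open>Symmetric monoidal categories and duals\<close>

record ('o, 'm) category =
  Obj :: "'o set"
  Arr :: "'m set"
  Dom :: "'m \<Rightarrow> 'o"
  Cod :: "'m \<Rightarrow> 'o"
  Ident :: "'o \<Rightarrow> 'm"
  Comp :: "'m \<Rightarrow> 'm \<Rightarrow> 'm"  (infixl "\<cdot>\<index>" 60)

definition Homset :: "('o, 'm, 'z) category_scheme \<Rightarrow> 'o \<Rightarrow> 'o \<Rightarrow> 'm set" where
  "Homset C X Y = {f \<in> Arr C. Dom C f = X \<and> Cod C f = Y}"

definition inverse_arrows :: "('o, 'm, 'z) category_scheme \<Rightarrow> 'm \<Rightarrow> 'm \<Rightarrow> bool" where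
  "inverse_arrows C f g \<longleftrightarrow>
     f \<in> Arr C \<and> g \<in> Homset C (Cod C f) (Dom C f) \<and>
     g \<cdot>\<^bsub>C\<^esub> f = Ident C (Dom C f) \<and> f \<cdot>\<^bsub>C\<^esub> g = Ident C (Cod C f)"

definition is_isomorphism :: "('o, 'm, 'z) category_scheme \<Rightarrow> 'm \<Rightarrow> bool" where
  "is_isomorphism C f \<longleftrightarrow> (\<exists>g. inverse_arrows C f g)"

definition inv_arrow :: "('o, 'm, 'z) category_scheme \<Rightarrow> 'm \<Rightarrow> 'm" where
  "inv_arrow C f = (THE g. inverse_arrows C f g)"

text \<open>
  The remaining structure of \<open>C\<close>, in particular a monoidal structure, is inherited unchanged.
\<close>

definition full_subcategory ::
    "('o, 'm, 'z) category_scheme \<Rightarrow> 'o set \<Rightarrow> ('o, 'm, 'z) category_scheme" where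
  "full_subcategory C S =
     C\<lparr>Obj := Obj C \<inter> S, Arr := {f \<in> Arr C. Dom C f \<in> S \<and> Cod C f \<in> S}\<rparr>"

locale category =
  fixes C :: "('o, 'm, 'z) category_scheme" (structure)
  assumes dom_obj: "f \<in> Arr C \<Longrightarrow> Dom C f \<in> Obj C"
    and cod_obj: "f \<in> Arr C \<Longrightarrow> Cod C f \<in> Obj C"
    and ident_hom: "X \<in> Obj C \<Longrightarrow> Ident C X \<in> Homset C X X"
    and comp_hom: "\<lbrakk>f \<in> Homset C X Y; g \<in> Homset C Y Z\<rbrakk> \<Longrightarrow> g \<cdot> f \<in> Homset C X Z"
    and comp_assoc: "\<lbrakk>f \<in> Homset C W X; g \<in> Homset C X Y; h \<in> Homset C Y Z\<rbrakk>
        \<Longrightarrow> h \<cdot> (g \<cdot> f) = h \<cdot> g \<cdot> f"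
    and ident_left: "f \<in> Homset C X Y \<Longrightarrow> Ident C Y \<cdot> f = f"
    and ident_right: "f \<in> Homset C X Y \<Longrightarrow> f \<cdot> Ident C X = f"

record ('o, 'm) sym_monoidal = "('o, 'm) category" +
  Unit :: 'o
  TenO :: "'o \<Rightarrow> 'o \<Rightarrow> 'o"  (infixl "\<odot>\<index>" 75)
  TenA :: "'m \<Rightarrow> 'm \<Rightarrow> 'm"  (infixl "\<boxtimes>\<index>" 75)
  Associator :: "'o \<Rightarrow> 'o \<Rightarrow> 'o \<Rightarrow> 'm"
  LUnitor :: "'o \<Rightarrow> 'm"
  RUnitor :: "'o \<Rightarrow> 'm"
  Braiding :: "'o \<Rightarrow> 'o \<Rightarrow> 'm"

locale symmetric_monoidal_category = category C
  for C :: "('o, 'm, 'z) sym_monoidal_scheme" (structure) +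
  assumes unit_obj: "Unit C \<in> Obj C"
    and tensor_obj: "\<lbrakk>X \<in> Obj C; Y \<in> Obj C\<rbrakk> \<Longrightarrow> X \<odot> Y \<in> Obj C"
    and tensor_hom: "\<lbrakk>f \<in> Homset C X X'; g \<in> Homset C Y Y'\<rbrakk>
        \<Longrightarrow> f \<boxtimes> g \<in> Homset C (X \<odot> Y) (X' \<odot> Y')"
    and tensor_ident: "\<lbrakk>X \<in> Obj C; Y \<in> Obj C\<rbrakk>
        \<Longrightarrow> Ident C X \<boxtimes> Ident C Y = Ident C (X \<odot> Y)"
    and tensor_comp: "\<lbrakk>f \<in> Homset C X X'; f' \<in> Homset C X' X'';
          g \<in> Homset C Y Y'; g' \<in> Homset C Y' Y''\<rbrakk>
        \<Longrightarrow> (f' \<cdot> f) \<boxtimes> (g' \<cdot> g) = (f' \<boxtimes> g') \<cdot> (f \<boxtimes> g)"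
    and assoc_hom: "\<lbrakk>X \<in> Obj C; Y \<in> Obj C; Z \<in> Obj C\<rbrakk>
        \<Longrightarrow> Associator C X Y Z \<in> Homset C (X \<odot> Y \<odot> Z) (X \<odot> (Y \<odot> Z))"
    and assoc_iso: "\<lbrakk>X \<in> Obj C; Y \<in> Obj C; Z \<in> Obj C\<rbrakk>
        \<Longrightarrow> is_isomorphism C (Associator C X Y Z)"
    and assoc_natural: "\<lbrakk>f \<in> Homset C X X'; g \<in> Homset C Y Y'; h \<in> Homset C Z Z'\<rbrakk>
        \<Longrightarrow> Associator C X' Y' Z' \<cdot> (f \<boxtimes> g \<boxtimes> h) = (f \<boxtimes> (g \<boxtimes> h)) \<cdot> Associator C X Y Z"
    and lunit_hom: "X \<in> Obj C \<Longrightarrow> LUnitor C X \<in> Homset C (Unit C \<odot> X) X"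
    and lunit_iso: "X \<in> Obj C \<Longrightarrow> is_isomorphism C (LUnitor C X)"
    and lunit_natural: "f \<in> Homset C X Y
        \<Longrightarrow> LUnitor C Y \<cdot> (Ident C (Unit C) \<boxtimes> f) = f \<cdot> LUnitor C X"
    and runit_hom: "X \<in> Obj C \<Longrightarrow> RUnitor C X \<in> Homset C (X \<odot> Unit C) X"
    and runit_iso: "X \<in> Obj C \<Longrightarrow> is_isomorphism C (RUnitor C X)"
    and runit_natural: "f \<in> Homset C X Y
        \<Longrightarrow> RUnitor C Y \<cdot> (f \<boxtimes> Ident C (Unit C)) = f \<cdot> RUnitor C X"
    and pentagon: "\<lbrakk>W \<in> Obj C; X \<in> Obj C; Y \<in> Obj C; Z \<in> Obj C\<rbrakk>
        \<Longrightarrow> Associator C W X (Y \<odot> Z) \<cdot> Associator C (W \<odot> X) Y Z =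
            (Ident C W \<boxtimes> Associator C X Y Z) \<cdot> Associator C W (X \<odot> Y) Z
              \<cdot> (Associator C W X Y \<boxtimes> Ident C Z)"
    and triangle: "\<lbrakk>X \<in> Obj C; Y \<in> Obj C\<rbrakk>
        \<Longrightarrow> (Ident C X \<boxtimes> LUnitor C Y) \<cdot> Associator C X (Unit C) Y = RUnitor C X \<boxtimes> Ident C Y"
    and braid_hom: "\<lbrakk>X \<in> Obj C; Y \<in> Obj C\<rbrakk>
        \<Longrightarrow> Braiding C X Y \<in> Homset C (X \<odot> Y) (Y \<odot> X)"
    and braid_natural: "\<lbrakk>f \<in> Homset C X X'; g \<in> Homset C Y Y'\<rbrakk>
        \<Longrightarrow> Braiding C X' Y' \<cdot> (f \<boxtimes> g) = (g \<boxtimes> f) \<cdot> Braiding C X Y"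
    and braid_symmetric: "\<lbrakk>X \<in> Obj C; Y \<in> Obj C\<rbrakk>
        \<Longrightarrow> Braiding C Y X \<cdot> Braiding C X Y = Ident C (X \<odot> Y)"
    and hexagon: "\<lbrakk>X \<in> Obj C; Y \<in> Obj C; Z \<in> Obj C\<rbrakk>
        \<Longrightarrow> Associator C Y Z X \<cdot> Braiding C X (Y \<odot> Z) \<cdot> Associator C X Y Z =
            (Ident C Y \<boxtimes> Braiding C X Z) \<cdot> Associator C Y X Z \<cdot> (Braiding C X Y \<boxtimes> Ident C Z)"

text \<open>
  The two zigzag identities, with the associators and unitors that are usually suppressed
  written out.
\<close>

definition is_dual ::
    "('o, 'm, 'z) sym_monoidal_scheme \<Rightarrow> 'o \<Rightarrow> 'o \<Rightarrow> 'm \<Rightarrow> 'm \<Rightarrow> bool" where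
  "is_dual C X X' ev coev \<longleftrightarrow>
     X \<in> Obj C \<and> X' \<in> Obj C \<and>
     ev \<in> Homset C (X' \<odot>\<^bsub>C\<^esub> X) (Unit C) \<and>
     coev \<in> Homset C (Unit C) (X \<odot>\<^bsub>C\<^esub> X') \<and>
     RUnitor C X \<cdot>\<^bsub>C\<^esub> (Ident C X \<boxtimes>\<^bsub>C\<^esub> ev) \<cdot>\<^bsub>C\<^esub> Associator C X X' X
       \<cdot>\<^bsub>C\<^esub> (coev \<boxtimes>\<^bsub>C\<^esub> Ident C X) \<cdot>\<^bsub>C\<^esub> inv_arrow C (LUnitor C X) = Ident C X \<and>
     LUnitor C X' \<cdot>\<^bsub>C\<^esub> (ev \<boxtimes>\<^bsub>C\<^esub> Ident C X') \<cdot>\<^bsub>C\<^esub> inv_arrow C (Associator C X' X X')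
       \<cdot>\<^bsub>C\<^esub> (Ident C X' \<boxtimes>\<^bsub>C\<^esub> coev) \<cdot>\<^bsub>C\<^esub> inv_arrow C (RUnitor C X') = Ident C X'"

locale rigid_symmetric_monoidal_category = symmetric_monoidal_category +
  assumes has_dual: "X \<in> Obj C \<Longrightarrow> \<exists>X' ev coev. is_dual C X X' ev coev"


section \<open>Boolean semimodules\<close>

text \<open>
  The commutative monoids of HOL-Algebra are written multiplicatively, so the addition and the
  zero of a semimodule appear as \<open>\<otimes>\<close> and \<open>\<one>\<close>, and finite sums as \<^const>\<open>finprod\<close>.
\<close>

locale boolean_semimodule = comm_monoid M for M (structure) +
  assumes idem: "x \<in> carrier M \<Longrightarrow> x \<otimes> x = x"

text \<open>
  Morphisms are restricted to the carrier, so that equality of morphisms is equality in HOL.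
\<close>

definition semimod_hom :: "'a monoid \<Rightarrow> 'b monoid \<Rightarrow> ('a \<Rightarrow> 'b) set" where
  "semimod_hom M N = {f \<in> hom M N. f \<one>\<^bsub>M\<^esub> = \<one>\<^bsub>N\<^esub>} \<inter> extensional (carrier M)"

definition bilinear ::
    "'a monoid \<Rightarrow> 'b monoid \<Rightarrow> 'c monoid \<Rightarrow> ('a \<Rightarrow> 'b \<Rightarrow> 'c) \<Rightarrow> bool" where
  "bilinear M N K f \<longleftrightarrow>
     (\<forall>y\<in>carrier N. (\<lambda>x\<in>carrier M. f x y) \<in> semimod_hom M K) \<and>
     (\<forall>x\<in>carrier M. (\<lambda>y\<in>carrier N. f x y) \<in> semimod_hom N K)"

lemma semimod_homD:
  assumes "f \<in> semimod_hom M N"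
  shows "x \<in> carrier M \<Longrightarrow> f x \<in> carrier N"
    and "\<lbrakk>x \<in> carrier M; y \<in> carrier M\<rbrakk> \<Longrightarrow> f (x \<otimes>\<^bsub>M\<^esub> y) = f x \<otimes>\<^bsub>N\<^esub> f y"
    and "f \<one>\<^bsub>M\<^esub> = \<one>\<^bsub>N\<^esub>"
    and "f \<in> extensional (carrier M)"
  using assms by (auto simp: semimod_hom_def hom_def)

lemma semimod_homI:
  assumes "\<And>x. x \<in> carrier M \<Longrightarrow> f x \<in> carrier N"
    and "\<And>x y. \<lbrakk>x \<in> carrier M; y \<in> carrier M\<rbrakk> \<Longrightarrow> f (x \<otimes>\<^bsub>M\<^esub> y) = f x \<otimes>\<^bsub>N\<^esub> f y"
    and "f \<one>\<^bsub>M\<^esub> = \<one>\<^bsub>N\<^esub>"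
    and "f \<in> extensional (carrier M)"
  shows "f \<in> semimod_hom M N"
  using assms by (auto simp: semimod_hom_def hom_def)

lemma bilinearD:
  assumes "bilinear M N K f" "monoid M" "monoid N"
  shows "\<lbrakk>x \<in> carrier M; y \<in> carrier N\<rbrakk> \<Longrightarrow> f x y \<in> carrier K"
    and "\<lbrakk>x \<in> carrier M; x' \<in> carrier M; y \<in> carrier N\<rbrakk>
        \<Longrightarrow> f (x \<otimes>\<^bsub>M\<^esub> x') y = f x y \<otimes>\<^bsub>K\<^esub> f x' y"
    and "\<lbrakk>x \<in> carrier M; y \<in> carrier N; y' \<in> carrier N\<rbrakk>
        \<Longrightarrow> f x (y \<otimes>\<^bsub>N\<^esub> y') = f x y \<otimes>\<^bsub>K\<^esub> f x y'"
    and "y \<in> carrier N \<Longrightarrow> f \<one>\<^bsub>M\<^esub> y = \<one>\<^bsub>K\<^esub>"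
    and "x \<in> carrier M \<Longrightarrow> f x \<one>\<^bsub>N\<^esub> = \<one>\<^bsub>K\<^esub>"
proof -
  interpret M: monoid M by fact
  interpret N: monoid N by fact
  have 1: "(\<lambda>x\<in>carrier M. f x y) \<in> semimod_hom M K" if "y \<in> carrier N" for y
    using assms that by (auto simp: bilinear_def)
  have 2: "(\<lambda>y\<in>carrier N. f x y) \<in> semimod_hom N K" if "x \<in> carrier M" for x
    using assms that by (auto simp: bilinear_def)
  show "f x y \<in> carrier K" if "x \<in> carrier M" "y \<in> carrier N"
    using semimod_homD(1)[OF 1] that by fastforce
  show "f (x \<otimes>\<^bsub>M\<^esub> x') y = f x y \<otimes>\<^bsub>K\<^esub> f x' y"
    if "x \<in> carrier M" "x' \<in> carrier M" "y \<in> carrier N"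
    using semimod_homD(2)[OF 1[OF that(3)] that(1,2)] that by simp
  show "f x (y \<otimes>\<^bsub>N\<^esub> y') = f x y \<otimes>\<^bsub>K\<^esub> f x y'"
    if "x \<in> carrier M" "y \<in> carrier N" "y' \<in> carrier N"
    using semimod_homD(2)[OF 2[OF that(1)] that(2,3)] that by simp
  show "f \<one>\<^bsub>M\<^esub> y = \<one>\<^bsub>K\<^esub>" if "y \<in> carrier N"
    using semimod_homD(3)[OF 1[OF that]] by simp
  show "f x \<one>\<^bsub>N\<^esub> = \<one>\<^bsub>K\<^esub>" if "x \<in> carrier M"
    using semimod_homD(3)[OF 2[OF that]] by simp
qed

context boolean_semimodule
begin

lemma finprod_absorb:
  assumes "finite A" "f \<in> A \<rightarrow> carrier M" "a \<in> A"
  shows "f a \<otimes> finprod M f A = finprod M f A"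
proof -
  have A: "A = insert a (A - {a})" using assms by blast
  have "finprod M f A = f a \<otimes> finprod M f (A - {a})"
    by (subst A, rule finprod_insert) (use assms in auto)
  moreover have "finprod M f (A - {a}) \<in> carrier M" by (rule finprod_closed) (use assms in auto)
  moreover have "f a \<in> carrier M" using assms by auto
  ultimately show ?thesis by (simp add: m_assoc[symmetric] idem)
qed

lemma finprod_Un:
  assumes "finite A" "finite B" "f \<in> A \<rightarrow> carrier M" "f \<in> B \<rightarrow> carrier M"
  shows "finprod M f (A \<union> B) = finprod M f A \<otimes> finprod M f B"
  using assms(1,3)
proof (induction A rule: finite_induct)
  case empty
  then show ?case using assms by simp
next
  case (insert a A)
  have c: "f a \<in> carrier M" "f \<in> A \<rightarrow> carrier M" "finprod M f A \<in> carrier M"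
    "finprod M f B \<in> carrier M"
    using insert assms by auto
  have IH: "finprod M f (A \<union> B) = finprod M f A \<otimes> finprod M f B"
    using insert.IH c by blast
  have i: "finprod M f (insert a A) = f a \<otimes> finprod M f A"
    using insert c by simp
  show ?case
  proof (cases "a \<in> B")
    case True
    then have "insert a A \<union> B = A \<union> B" by blast
    moreover have "f a \<otimes> finprod M f B = finprod M f B"
      using finprod_absorb[of B f a] True assms by blast
    ultimately show ?thesis using IH i c by (metis m_assoc m_comm)
  next
    case False
    then have "finprod M f (insert a (A \<union> B)) = f a \<otimes> finprod M f (A \<union> B)"
      using insert c assms by (intro finprod_insert) auto
    then show ?thesis using IH i c by (simp add: m_assoc)
  qed
qed

end

lemma semimod_hom_finprod:
  assumes "boolean_semimodule M" "boolean_semimodule N" "h \<in> semimod_hom M N"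
    "finite A" "f \<in> A \<rightarrow> carrier M"
  shows "h (finprod M f A) = finprod N (\<lambda>x. h (f x)) A"
proof -
  interpret M: boolean_semimodule M by fact
  interpret N: boolean_semimodule N by fact
  show ?thesis
    using assms(4,5)
  proof (induction A rule: finite_induct)
    case empty
    then show ?case using semimod_homD(3)[OF assms(3)] by simp
  next
    case (insert a A)
    have "f a \<in> carrier M" "f \<in> A \<rightarrow> carrier M" using insert by auto
    moreover have "(\<lambda>x. h (f x)) \<in> A \<rightarrow> carrier N" "h (f a) \<in> carrier N"
      using semimod_homD(1)[OF assms(3)] calculation by auto
    ultimately show ?case
      using insert by (simp add: semimod_homD(2)[OF assms(3)])
  qed
qed


section \<open>A universe of carriers\<close>

text \<open>
  HOL has no type of all sets. Objects are therefore semimodules whose carrier is a set of elements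
  of the following type, which is closed under pairs and finite sets and hence under all the
  constructions below. Via \<open>VAtom\<close> it contains a copy of every semimodule carried by the arbitrary
  type \<open>'a\<close>.
\<close>

datatype 'a univ = VAtom 'a | VBool bool | VPair "'a univ" "'a univ" | VSet "'a univ fset"

definition code_set :: "'a univ set \<Rightarrow> 'a univ" where
  "code_set A = VSet (Abs_fset A)"

lemma code_set_inject: "\<lbrakk>finite A; finite B\<rbrakk> \<Longrightarrow> code_set A = code_set B \<longleftrightarrow> A = B"
  by (simp add: code_set_def Abs_fset_inject)

definition boole :: "'a univ monoid" where
  "boole = \<lparr>carrier = range VBool,
     mult = (\<lambda>x y. if x = VBool True \<or> y = VBool True then VBool True else VBool False),
     one = VBool False\<rparr>"

text \<open>
  Here \<open>M\<close> and \<open>N\<close> range over the semimodules in the universe, finite or not. For finite \<open>P\<close> this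
  entails the lifting property against surjections between semimodules over arbitrary types, see
  \<open>projective_lifts\<close> below.
\<close>

definition projective :: "'a univ monoid \<Rightarrow> bool" where
  "projective P \<longleftrightarrow> boolean_semimodule P \<and>
     (\<forall>(M :: 'a univ monoid) (N :: 'a univ monoid) g.
        boolean_semimodule M \<and> boolean_semimodule N \<and>
        g \<in> semimod_hom M N \<and> g ` carrier M = carrier N \<longrightarrow>
        (\<forall>h\<in>semimod_hom P N. \<exists>k\<in>semimod_hom P M. compose (carrier P) g k = h))"


section \<open>Tensor products\<close>

text \<open>
  The tensor product is the free semimodule on \<open>M \<times> N\<close>, that is the finite subsets of \<open>M \<times> N\<close> under
  union, modulo the least congruence that makes \<open>(x, y) \<mapsto> {(x, y)}\<close> bilinear.
  For finite \<open>M\<close> and \<open>N\<close> its universal property is \<open>tensor_universal\<close> below.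
\<close>

definition formal_sums :: "'a monoid \<Rightarrow> 'b monoid \<Rightarrow> ('a \<times> 'b) set set" where
  "formal_sums M N = {S. finite S \<and> S \<subseteq> carrier M \<times> carrier N}"

inductive tensor_cong ::
    "'a monoid \<Rightarrow> 'b monoid \<Rightarrow> ('a \<times> 'b) set \<Rightarrow> ('a \<times> 'b) set \<Rightarrow> bool"
  for M N where
  refl: "S \<in> formal_sums M N \<Longrightarrow> tensor_cong M N S S"
| sym: "tensor_cong M N S T \<Longrightarrow> tensor_cong M N T S"
| trans: "\<lbrakk>tensor_cong M N S T; tensor_cong M N T U\<rbrakk> \<Longrightarrow> tensor_cong M N S U"
| union: "\<lbrakk>tensor_cong M N S S'; tensor_cong M N T T'\<rbrakk> \<Longrightarrow> tensor_cong M N (S \<union> T) (S' \<union> T')"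
| add_left: "\<lbrakk>x \<in> carrier M; x' \<in> carrier M; y \<in> carrier N\<rbrakk>
    \<Longrightarrow> tensor_cong M N {(x \<otimes>\<^bsub>M\<^esub> x', y)} {(x, y), (x', y)}"
| add_right: "\<lbrakk>x \<in> carrier M; y \<in> carrier N; y' \<in> carrier N\<rbrakk>
    \<Longrightarrow> tensor_cong M N {(x, y \<otimes>\<^bsub>N\<^esub> y')} {(x, y), (x, y')}"
| zero_left: "y \<in> carrier N \<Longrightarrow> tensor_cong M N {(\<one>\<^bsub>M\<^esub>, y)} {}"
| zero_right: "x \<in> carrier M \<Longrightarrow> tensor_cong M N {(x, \<one>\<^bsub>N\<^esub>)} {}"

definition tensor_class ::
    "'a univ monoid \<Rightarrow> 'a univ monoid \<Rightarrow> ('a univ \<times> 'a univ) set \<Rightarrow> 'a univ" where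
  "tensor_class M N S =
     code_set ((\<lambda>T. code_set ((\<lambda>(x, y). VPair x y) ` T)) ` {T. tensor_cong M N S T})"

definition tensor_rep ::
    "'a univ monoid \<Rightarrow> 'a univ monoid \<Rightarrow> 'a univ \<Rightarrow> ('a univ \<times> 'a univ) set" where
  "tensor_rep M N c = (SOME S. S \<in> formal_sums M N \<and> tensor_class M N S = c)"

definition tensor :: "'a univ monoid \<Rightarrow> 'a univ monoid \<Rightarrow> 'a univ monoid" where
  "tensor M N = \<lparr>carrier = tensor_class M N ` formal_sums M N,
     mult = (\<lambda>c d. tensor_class M N (tensor_rep M N c \<union> tensor_rep M N d)),
     one = tensor_class M N {}\<rparr>"

definition pure_tensor ::
    "'a univ monoid \<Rightarrow> 'a univ monoid \<Rightarrow> 'a univ \<Rightarrow> 'a univ \<Rightarrow> 'a univ" where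
  "pure_tensor M N x y = tensor_class M N {(x, y)}"

text \<open>The homomorphism out of the tensor product induced by a bilinear map.\<close>

definition tensor_lift ::
    "'a univ monoid \<Rightarrow> 'a univ monoid \<Rightarrow> 'c monoid \<Rightarrow> ('a univ \<Rightarrow> 'a univ \<Rightarrow> 'c) \<Rightarrow> 'a univ \<Rightarrow> 'c"
  where
  "tensor_lift M N K f =
     (\<lambda>c\<in>carrier (tensor M N). finprod K (case_prod f) (tensor_rep M N c))"

locale finite_pair =
  fixes M N :: "'a univ monoid"
  assumes M: "boolean_semimodule M" and N: "boolean_semimodule N"
    and finite_M: "finite (carrier M)" and finite_N: "finite (carrier N)"
begin

sublocale M: boolean_semimodule M by (rule M)
sublocale N: boolean_semimodule N by (rule N)

lemma tensor_cong_formal: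
  "tensor_cong M N S T \<Longrightarrow> S \<in> formal_sums M N \<and> T \<in> formal_sums M N"
  by (induction rule: tensor_cong.induct) (auto simp: formal_sums_def)

lemma finite_formal_sums: "finite (formal_sums M N)"
proof -
  have "formal_sums M N \<subseteq> Pow (carrier M \<times> carrier N)" by (auto simp: formal_sums_def)
  then show ?thesis using finite_M finite_N by (meson finite_Pow_iff finite_SigmaI finite_subset)
qed

lemma code_pairs_inject:
  assumes "S \<in> formal_sums M N" "T \<in> formal_sums M N"
    "code_set ((\<lambda>(x, y). VPair x y) ` S) = code_set ((\<lambda>(x, y). VPair x y) ` T)"
  shows "S = T"
proof -
  have "inj (\<lambda>(x, y). VPair x (y :: 'a univ))" by (auto simp: inj_on_def)
  then show ?thesis using assms
    by (auto simp: formal_sums_def code_set_inject inj_image_eq_iff)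
qed

lemma tensor_class_eq_iff:
  assumes S: "S \<in> formal_sums M N" and T: "T \<in> formal_sums M N"
  shows "tensor_class M N S = tensor_class M N T \<longleftrightarrow> tensor_cong M N S T"
proof -
  have sub: "{U. tensor_cong M N V U} \<subseteq> formal_sums M N" for V
    using tensor_cong_formal by blast
  then have fin: "finite {U. tensor_cong M N V U}" for V
    using finite_formal_sums finite_subset by blast
  have inj: "inj_on (\<lambda>T. code_set ((\<lambda>(x, y). VPair x y) ` T)) (formal_sums M N)"
    by (intro inj_onI code_pairs_inject)
  have "tensor_class M N S = tensor_class M N T \<longleftrightarrow>
      {U. tensor_cong M N S U} = {U. tensor_cong M N T U}"
    unfolding tensor_class_def
    by (simp only: code_set_inject[OF finite_imageI[OF fin] finite_imageI[OF fin]]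
        inj_on_image_eq_iff[OF inj sub sub])
  also have "\<dots> \<longleftrightarrow> tensor_cong M N S T"
    using tensor_cong.refl[OF T] by (auto intro: tensor_cong.sym tensor_cong.trans)
  finally show ?thesis .
qed

lemma tensor_rep:
  assumes "c \<in> carrier (tensor M N)"
  shows "tensor_rep M N c \<in> formal_sums M N" "tensor_class M N (tensor_rep M N c) = c"
proof -
  have "\<exists>S. S \<in> formal_sums M N \<and> tensor_class M N S = c"
    using assms by (auto simp: tensor_def)
  from someI_ex[OF this]
  show "tensor_rep M N c \<in> formal_sums M N" "tensor_class M N (tensor_rep M N c) = c"
    by (auto simp: tensor_rep_def)
qed

lemma tensor_rep_class:
  assumes "S \<in> formal_sums M N"
  shows "tensor_cong M N (tensor_rep M N (tensor_class M N S)) S"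
proof -
  have c: "tensor_class M N S \<in> carrier (tensor M N)" using assms by (auto simp: tensor_def)
  show ?thesis using tensor_rep[OF c] assms tensor_class_eq_iff by blast
qed

lemma formal_sums_Un:
  "\<lbrakk>S \<in> formal_sums M N; T \<in> formal_sums M N\<rbrakk> \<Longrightarrow> S \<union> T \<in> formal_sums M N"
  by (auto simp: formal_sums_def)

lemma formal_sums_empty: "{} \<in> formal_sums M N"
  by (auto simp: formal_sums_def)

lemma tensor_class_closed: "S \<in> formal_sums M N \<Longrightarrow> tensor_class M N S \<in> carrier (tensor M N)"
  by (simp add: tensor_def)

lemma tensor_class_Un:
  assumes "S \<in> formal_sums M N" "T \<in> formal_sums M N"
  shows "tensor_class M N S \<otimes>\<^bsub>tensor M N\<^esub> tensor_class M N T = tensor_class M N (S \<union> T)"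
proof -
  have "tensor_cong M N (tensor_rep M N (tensor_class M N S) \<union> tensor_rep M N (tensor_class M N T))
      (S \<union> T)"
    using assms tensor_rep_class by (intro tensor_cong.union) auto
  then show ?thesis
    using tensor_cong_formal tensor_class_eq_iff by (auto simp: tensor_def)
qed

lemma one_tensor: "\<one>\<^bsub>tensor M N\<^esub> = tensor_class M N {}"
  by (simp add: tensor_def)

lemma tensor_cases:
  assumes "c \<in> carrier (tensor M N)"
  obtains S where "S \<in> formal_sums M N" "c = tensor_class M N S"
  using assms by (auto simp: tensor_def)

lemma tensor_semimodule: "boolean_semimodule (tensor M N)"
proof unfold_locales
  show "x \<otimes>\<^bsub>tensor M N\<^esub> y \<in> carrier (tensor M N)"
    if "x \<in> carrier (tensor M N)" "y \<in> carrier (tensor M N)" for x y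
    using that by (auto elim!: tensor_cases simp: tensor_class_Un formal_sums_Un tensor_class_closed)
  show "\<one>\<^bsub>tensor M N\<^esub> \<in> carrier (tensor M N)"
    by (simp add: one_tensor tensor_class_closed formal_sums_empty)
  show "x \<otimes>\<^bsub>tensor M N\<^esub> y \<otimes>\<^bsub>tensor M N\<^esub> z = x \<otimes>\<^bsub>tensor M N\<^esub> (y \<otimes>\<^bsub>tensor M N\<^esub> z)"
    if "x \<in> carrier (tensor M N)" "y \<in> carrier (tensor M N)" "z \<in> carrier (tensor M N)" for x y z
    using that by (auto elim!: tensor_cases simp: tensor_class_Un formal_sums_Un Un_assoc)
  show "x \<otimes>\<^bsub>tensor M N\<^esub> y = y \<otimes>\<^bsub>tensor M N\<^esub> x"
    if "x \<in> carrier (tensor M N)" "y \<in> carrier (tensor M N)" for x y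
    using that by (auto elim!: tensor_cases simp: tensor_class_Un Un_commute)
qed (auto elim!: tensor_cases simp: tensor_class_Un one_tensor formal_sums_empty)

lemma finite_tensor: "finite (carrier (tensor M N))"
  by (simp add: tensor_def finite_formal_sums)

lemma pure_closed:
  "\<lbrakk>x \<in> carrier M; y \<in> carrier N\<rbrakk> \<Longrightarrow> pure_tensor M N x y \<in> carrier (tensor M N)"
  by (simp add: pure_tensor_def tensor_class_closed formal_sums_def)

lemma pure_bilinear: "bilinear M N (tensor M N) (pure_tensor M N)"
proof -
  have fs: "\<lbrakk>x \<in> carrier M; y \<in> carrier N\<rbrakk> \<Longrightarrow> {(x, y)} \<in> formal_sums M N"
    "\<lbrakk>x \<in> carrier M; y \<in> carrier N; x' \<in> carrier M; y' \<in> carrier N\<rbrakk>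
      \<Longrightarrow> {(x, y), (x', y')} \<in> formal_sums M N" for x y x' y'
    by (auto simp: formal_sums_def)
  show ?thesis
    unfolding bilinear_def
  proof (intro conjI ballI semimod_homI)
    fix x y assume "x \<in> carrier M" "y \<in> carrier N"
    then show "(\<lambda>x\<in>carrier M. pure_tensor M N x y) x \<in> carrier (tensor M N)"
      "(\<lambda>y\<in>carrier N. pure_tensor M N x y) y \<in> carrier (tensor M N)"
      by (simp_all add: pure_closed)
  next
    fix x x' y assume "x \<in> carrier M" "x' \<in> carrier M" "y \<in> carrier N"
    then show "(\<lambda>x\<in>carrier M. pure_tensor M N x y) (x \<otimes>\<^bsub>M\<^esub> x') =
        (\<lambda>x\<in>carrier M. pure_tensor M N x y) x \<otimes>\<^bsub>tensor M N\<^esub>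
        (\<lambda>x\<in>carrier M. pure_tensor M N x y) x'"
      using tensor_cong.add_left[of x M x' y N]
      by (simp add: pure_tensor_def tensor_class_Un tensor_class_eq_iff fs insert_commute)
  next
    fix x y y' assume "x \<in> carrier M" "y \<in> carrier N" "y' \<in> carrier N"
    then show "(\<lambda>y\<in>carrier N. pure_tensor M N x y) (y \<otimes>\<^bsub>N\<^esub> y') =
        (\<lambda>y\<in>carrier N. pure_tensor M N x y) y \<otimes>\<^bsub>tensor M N\<^esub>
        (\<lambda>y\<in>carrier N. pure_tensor M N x y) y'"
      using tensor_cong.add_right[of x M y N y']
      by (simp add: pure_tensor_def tensor_class_Un tensor_class_eq_iff fs insert_commute)
  next
    fix y assume "y \<in> carrier N"
    then show "(\<lambda>x\<in>carrier M. pure_tensor M N x y) \<one>\<^bsub>M\<^esub> = \<one>\<^bsub>tensor M N\<^esub>"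
      by (simp add: one_tensor pure_tensor_def tensor_class_eq_iff fs formal_sums_empty
          tensor_cong.zero_left)
  next
    fix x assume "x \<in> carrier M"
    then show "(\<lambda>y\<in>carrier N. pure_tensor M N x y) \<one>\<^bsub>N\<^esub> = \<one>\<^bsub>tensor M N\<^esub>"
      by (simp add: one_tensor pure_tensor_def tensor_class_eq_iff fs formal_sums_empty
          tensor_cong.zero_right)
  qed auto
qed

lemma tensor_class_sum:
  assumes "S \<in> formal_sums M N"
  shows "tensor_class M N S = finprod (tensor M N) (case_prod (pure_tensor M N)) S"
proof -
  interpret T: boolean_semimodule "tensor M N" by (rule tensor_semimodule)
  have "finite S" "S \<subseteq> carrier M \<times> carrier N" using assms by (auto simp: formal_sums_def)
  then show ?thesis
  proof (induction S rule: finite_induct)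
    case empty
    then show ?case by (simp add: one_tensor)
  next
    case (insert p S)
    obtain x y where p: "p = (x, y)" "x \<in> carrier M" "y \<in> carrier N" using insert by auto
    have "S \<in> formal_sums M N" "{p} \<in> formal_sums M N" using insert by (auto simp: formal_sums_def)
    then have "tensor_class M N (insert p S) =
        tensor_class M N {p} \<otimes>\<^bsub>tensor M N\<^esub> tensor_class M N S"
      by (subst tensor_class_Un) auto
    also have "\<dots> = pure_tensor M N x y \<otimes>\<^bsub>tensor M N\<^esub>
        finprod (tensor M N) (case_prod (pure_tensor M N)) S"
    proof -
      have "tensor_class M N {p} = pure_tensor M N x y" by (simp add: p pure_tensor_def)
      moreover have "tensor_class M N S = finprod (tensor M N) (case_prod (pure_tensor M N)) S"
        using insert by blast
      ultimately show ?thesis by (simp only:)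
    qed
    also have "\<dots> = finprod (tensor M N) (case_prod (pure_tensor M N)) (insert p S)"
      using insert p pure_closed by (subst T.finprod_insert) (auto simp: Pi_iff)
    finally show ?case .
  qed
qed

lemma finprod_tensor_cong:
  assumes "boolean_semimodule K" "bilinear M N K f" "tensor_cong M N S T"
  shows "finprod K (case_prod f) S = finprod K (case_prod f) T"
proof -
  interpret K: boolean_semimodule K by fact
  note bD = bilinearD[OF assms(2) M.monoid_axioms N.monoid_axioms]
  have pi: "case_prod f \<in> S \<rightarrow> carrier K" if "S \<in> formal_sums M N" for S
    using that bD(1) by (auto simp: formal_sums_def)
  have two: "finprod K (case_prod f) {(x, y), (x', y')} = f x y \<otimes>\<^bsub>K\<^esub> f x' y'"
    if "x \<in> carrier M" "y \<in> carrier N" "x' \<in> carrier M" "y' \<in> carrier N" for x y x' y'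
  proof -
    have "finprod K (case_prod f) ({(x, y)} \<union> {(x', y')}) =
        finprod K (case_prod f) {(x, y)} \<otimes>\<^bsub>K\<^esub> finprod K (case_prod f) {(x', y')}"
      using that bD(1) by (intro K.finprod_Un) auto
    then show ?thesis using that bD(1) by (simp add: insert_commute)
  qed
  show ?thesis
    using assms(3)
  proof (induction rule: tensor_cong.induct)
    case (union S S' T T')
    then have "S \<in> formal_sums M N" "S' \<in> formal_sums M N" "T \<in> formal_sums M N"
      "T' \<in> formal_sums M N"
      using tensor_cong_formal by auto
    then show ?case
      using union pi by (simp add: K.finprod_Un formal_sums_def)
  qed (simp_all add: two bD)
qed

lemma tensor_lift_class:
  assumes "boolean_semimodule K" "bilinear M N K f" "S \<in> formal_sums M N"
  shows "tensor_lift M N K f (tensor_class M N S) = finprod K (case_prod f) S"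
  using assms finprod_tensor_cong[OF assms(1,2) tensor_rep_class[OF assms(3)]]
  by (simp add: tensor_lift_def tensor_class_closed)

lemma tensor_lift_pure:
  assumes "boolean_semimodule K" "bilinear M N K f" "x \<in> carrier M" "y \<in> carrier N"
  shows "tensor_lift M N K f (pure_tensor M N x y) = f x y"
proof -
  interpret K: boolean_semimodule K by fact
  have "f x y \<in> carrier K"
    using bilinearD(1)[OF assms(2) M.monoid_axioms N.monoid_axioms] assms by blast
  then show ?thesis
    using assms tensor_lift_class[OF assms(1,2), of "{(x, y)}"]
    by (simp add: pure_tensor_def formal_sums_def)
qed

lemma tensor_lift_hom:
  assumes "boolean_semimodule K" "bilinear M N K f"
  shows "tensor_lift M N K f \<in> semimod_hom (tensor M N) K"
proof -
  interpret K: boolean_semimodule K by fact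
  have pi: "case_prod f \<in> S \<rightarrow> carrier K" if "S \<in> formal_sums M N" for S
    using that bilinearD(1)[OF assms(2) M.monoid_axioms N.monoid_axioms]
    by (auto simp: formal_sums_def)
  have fin: "finite S" if "S \<in> formal_sums M N" for S using that by (simp add: formal_sums_def)
  show ?thesis
  proof (rule semimod_homI)
    show "tensor_lift M N K f c \<in> carrier K" if "c \<in> carrier (tensor M N)" for c
      using that pi by (auto elim!: tensor_cases simp: tensor_lift_class[OF assms])
    show "tensor_lift M N K f (c \<otimes>\<^bsub>tensor M N\<^esub> d) =
        tensor_lift M N K f c \<otimes>\<^bsub>K\<^esub> tensor_lift M N K f d"
      if "c \<in> carrier (tensor M N)" "d \<in> carrier (tensor M N)" for c d
      using that pi fin
      by (auto elim!: tensor_cases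
          simp: tensor_class_Un tensor_lift_class[OF assms] formal_sums_Un K.finprod_Un)
    show "tensor_lift M N K f \<one>\<^bsub>tensor M N\<^esub> = \<one>\<^bsub>K\<^esub>"
      by (simp add: one_tensor tensor_lift_class[OF assms] formal_sums_empty)
  qed (simp add: tensor_lift_def)
qed

theorem tensor_universal:
  assumes "boolean_semimodule K" "bilinear M N K f"
  shows "\<exists>!h. h \<in> semimod_hom (tensor M N) K \<and>
      (\<forall>x\<in>carrier M. \<forall>y\<in>carrier N. h (pure_tensor M N x y) = f x y)"
proof (rule ex1I[where a = "tensor_lift M N K f"])
  show "tensor_lift M N K f \<in> semimod_hom (tensor M N) K \<and>
      (\<forall>x\<in>carrier M. \<forall>y\<in>carrier N. tensor_lift M N K f (pure_tensor M N x y) = f x y)"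
    using tensor_lift_hom[OF assms] tensor_lift_pure[OF assms] by blast
next
  fix h
  assume h: "h \<in> semimod_hom (tensor M N) K \<and>
      (\<forall>x\<in>carrier M. \<forall>y\<in>carrier N. h (pure_tensor M N x y) = f x y)"
  interpret K: boolean_semimodule K by fact
  show "h = tensor_lift M N K f"
  proof (rule extensionalityI)
    show "h \<in> extensional (carrier (tensor M N))" using h semimod_homD(4) by blast
    show "tensor_lift M N K f \<in> extensional (carrier (tensor M N))" by (simp add: tensor_lift_def)
    fix c assume "c \<in> carrier (tensor M N)"
    then obtain S where S: "S \<in> formal_sums M N" "c = tensor_class M N S" by (rule tensor_cases)
    have S': "finite S" "S \<subseteq> carrier M \<times> carrier N" using S by (auto simp: formal_sums_def)
    have "h c = finprod K (\<lambda>p. h (case_prod (pure_tensor M N) p)) S"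
      unfolding S(2) tensor_class_sum[OF S(1)]
      using h S' pure_closed
      by (intro semimod_hom_finprod tensor_semimodule assms) (auto simp: Pi_iff)
    also have "\<dots> = finprod K (case_prod f) S"
    proof (rule K.finprod_cong')
      show "case_prod f \<in> S \<rightarrow> carrier K"
        using bilinearD(1)[OF assms(2) M.monoid_axioms N.monoid_axioms] S' by auto
    qed (use h S' in auto)
    also have "\<dots> = tensor_lift M N K f c" using S tensor_lift_class[OF assms] by simp
    finally show "h c = tensor_lift M N K f c" .
  qed
qed

end


section \<open>The category of finite Boolean semimodules\<close>

datatype 'a semimod_arrow =
  Arrow (src: "'a univ monoid") (tgt: "'a univ monoid") (fun_of: "'a univ \<Rightarrow> 'a univ")

definition finite_semimodules :: "('a univ monoid, 'a semimod_arrow) sym_monoidal" where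
  "finite_semimodules = \<lparr>
     Obj = {M. boolean_semimodule M \<and> finite (carrier M)},
     Arr = {Arrow M N f | M N f.
       boolean_semimodule M \<and> finite (carrier M) \<and> boolean_semimodule N \<and> finite (carrier N) \<and>
       f \<in> semimod_hom M N},
     Dom = src,
     Cod = tgt,
     Ident = (\<lambda>M. Arrow M M (\<lambda>x\<in>carrier M. x)),
     Comp = (\<lambda>g f. Arrow (src f) (tgt g) (compose (carrier (src f)) (fun_of g) (fun_of f))),
     Unit = boole,
     TenO = tensor,
     TenA = (\<lambda>f g. Arrow (tensor (src f) (src g)) (tensor (tgt f) (tgt g))
       (tensor_lift (src f) (src g) (tensor (tgt f) (tgt g))
         (\<lambda>x y. pure_tensor (tgt f) (tgt g) (fun_of f x) (fun_of g y)))),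
     Associator = (\<lambda>M N K. Arrow (tensor (tensor M N) K) (tensor M (tensor N K))
       (tensor_lift (tensor M N) K (tensor M (tensor N K))
         (\<lambda>t z. tensor_lift M N (tensor M (tensor N K))
           (\<lambda>x y. pure_tensor M (tensor N K) x (pure_tensor N K y z)) t))),
     LUnitor = (\<lambda>M. Arrow (tensor boole M) M
       (tensor_lift boole M M (\<lambda>b x. if b = VBool True then x else \<one>\<^bsub>M\<^esub>))),
     RUnitor = (\<lambda>M. Arrow (tensor M boole) M
       (tensor_lift M boole M (\<lambda>x b. if b = VBool True then x else \<one>\<^bsub>M\<^esub>))),
     Braiding = (\<lambda>M N. Arrow (tensor M N) (tensor N M)
       (tensor_lift M N (tensor N M) (\<lambda>x y. pure_tensor N M y x)))\<rparr>"


definition finite_projective_semimodules ::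
    "('a univ monoid, 'a semimod_arrow) sym_monoidal" where
  "finite_projective_semimodules = full_subcategory finite_semimodules {P. projective P}"


section \<open>Duals\<close>

text \<open>A function on the carrier of \<open>P\<close> is represented in the universe by its graph.\<close>

definition code_fun :: "'a univ monoid \<Rightarrow> ('a univ \<Rightarrow> 'a univ) \<Rightarrow> 'a univ" where
  "code_fun P f = code_set ((\<lambda>x. VPair x (f x)) ` carrier P)"

definition decode_fun ::
    "'a univ monoid \<Rightarrow> 'a univ monoid \<Rightarrow> 'a univ \<Rightarrow> 'a univ \<Rightarrow> 'a univ" where
  "decode_fun P K = the_inv_into (semimod_hom P K) (code_fun P)"

lemma decode_code_fun:
  assumes "finite (carrier P)" "f \<in> semimod_hom P K"
  shows "decode_fun P K (code_fun P f) = f"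
proof -
  have "inj_on (code_fun P) (semimod_hom P K)"
  proof (rule inj_onI)
    fix f g assume fg: "f \<in> semimod_hom P K" "g \<in> semimod_hom P K" "code_fun P f = code_fun P g"
    then have "(\<lambda>x. VPair x (f x)) ` carrier P = (\<lambda>x. VPair x (g x)) ` carrier P"
      using assms(1) by (simp add: code_fun_def code_set_inject)
    then have "f x = g x" if "x \<in> carrier P" for x using that by (auto simp: set_eq_iff image_iff)
    then show "f = g" using fg semimod_homD(4) by (blast intro: extensionalityI)
  qed
  then show ?thesis using assms(2) by (simp add: decode_fun_def the_inv_into_f_f)
qed

definition hom_semimodule :: "'a univ monoid \<Rightarrow> 'a univ monoid \<Rightarrow> 'a univ monoid" where
  "hom_semimodule P K = \<lparr>carrier = code_fun P ` semimod_hom P K,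
     mult = (\<lambda>\<phi> \<psi>. code_fun P (\<lambda>x\<in>carrier P. decode_fun P K \<phi> x \<otimes>\<^bsub>K\<^esub> decode_fun P K \<psi> x)),
     one = code_fun P (\<lambda>x\<in>carrier P. \<one>\<^bsub>K\<^esub>)\<rparr>"

definition dual_semimodule :: "'a univ monoid \<Rightarrow> 'a univ monoid" where
  "dual_semimodule P = hom_semimodule P boole"

definition evaluation :: "'a univ monoid \<Rightarrow> 'a semimod_arrow" where
  "evaluation P = Arrow (tensor (dual_semimodule P) P) boole
     (tensor_lift (dual_semimodule P) P boole (\<lambda>\<phi> y. decode_fun P boole \<phi> y))"


section \<open>Projectivity does not depend on the universe\<close>

theorem projective_lifts:
  fixes P :: "'a univ monoid" and M :: "'b monoid" and N :: "'c monoid"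
  assumes P: "projective P" "finite (carrier P)"
    and M: "boolean_semimodule M" and N: "boolean_semimodule N"
    and g: "g \<in> semimod_hom M N" "g ` carrier M = carrier N"
    and h: "h \<in> semimod_hom P N"
  shows "\<exists>k\<in>semimod_hom P M. compose (carrier P) g k = h"
proof -
  interpret P: boolean_semimodule P using P by (simp add: projective_def)
  interpret M: boolean_semimodule M by fact
  interpret N: boolean_semimodule N by fact
  define un :: "'a univ \<Rightarrow> 'a univ set" where "un = the_inv_into (Pow (carrier P)) code_set"
  have un: "un (code_set A) = A" if "A \<subseteq> carrier P" for A
  proof -
    have "inj_on code_set (Pow (carrier P))"
      using P(2) by (auto intro!: inj_onI simp: code_set_inject finite_subset)
    then show ?thesis using that by (simp add: un_def the_inv_into_f_f)
  qed
  have fin: "finite A" if "A \<subseteq> carrier P" for A using that P(2) finite_subset by blast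
  define F :: "'a univ monoid" where
    "F = \<lparr>carrier = code_set ` Pow (carrier P), mult = (\<lambda>c d. code_set (un c \<union> un d)),
      one = code_set {}\<rparr>"
  have F_simps: "carrier F = code_set ` Pow (carrier P)" "\<one>\<^bsub>F\<^esub> = code_set {}"
    "\<And>c d. c \<otimes>\<^bsub>F\<^esub> d = code_set (un c \<union> un d)"
    by (simp_all add: F_def)
  have F: "boolean_semimodule F"
    by unfold_locales (auto simp: F_simps un Un_ac)
  define \<pi> where "\<pi> = (\<lambda>c\<in>carrier F. finprod P (\<lambda>x. x) (un c))"
  have \<pi>_hom: "\<pi> \<in> semimod_hom F P"
  proof (rule semimod_homI)
    show "\<pi> c \<in> carrier P" if "c \<in> carrier F" for c
      using that by (auto simp: \<pi>_def F_simps un intro!: P.finprod_closed)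
    show "\<pi> (c \<otimes>\<^bsub>F\<^esub> d) = \<pi> c \<otimes>\<^bsub>P\<^esub> \<pi> d"
      if cd: "c \<in> carrier F" "d \<in> carrier F" for c d
    proof -
      obtain A B where AB: "c = code_set A" "d = code_set B" "A \<subseteq> carrier P" "B \<subseteq> carrier P"
        using cd unfolding F_simps(1) by blast
      have "finprod P (\<lambda>x. x) (A \<union> B) = finprod P (\<lambda>x. x) A \<otimes>\<^bsub>P\<^esub> finprod P (\<lambda>x. x) B"
        using AB fin by (intro P.finprod_Un) auto
      then show ?thesis using AB by (simp add: \<pi>_def F_simps un)
    qed
  qed (auto simp: \<pi>_def F_simps un)
  have \<pi>_surj: "\<pi> ` carrier F = carrier P"
  proof
    show "\<pi> ` carrier F \<subseteq> carrier P" using semimod_homD(1)[OF \<pi>_hom] by blast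
    show "carrier P \<subseteq> \<pi> ` carrier F"
    proof
      fix x assume x: "x \<in> carrier P"
      then have "\<pi> (code_set {x}) = x" by (simp add: \<pi>_def F_simps un)
      moreover have "code_set {x} \<in> carrier F" using x by (simp add: F_simps)
      ultimately show "x \<in> \<pi> ` carrier F" by (metis imageI)
    qed
  qed
  have id_hom: "(\<lambda>x\<in>carrier P. x) \<in> semimod_hom P P"
    by (rule semimod_homI) auto
  obtain s where s: "s \<in> semimod_hom P F" "compose (carrier P) \<pi> s = (\<lambda>x\<in>carrier P. x)"
    using P(1) F P.boolean_semimodule_axioms \<pi>_hom \<pi>_surj id_hom unfolding projective_def by meson
  have \<pi>s: "\<pi> (s x) = x" if "x \<in> carrier P" for x
    using fun_cong[OF s(2), of x] that by (simp add: compose_def)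
  have "\<forall>x\<in>carrier P. \<exists>u\<in>carrier M. g u = h x"
    using g(2) semimod_homD(1)[OF h] by (metis imageE)
  then obtain u where u: "\<And>x. x \<in> carrier P \<Longrightarrow> u x \<in> carrier M" "\<And>x. x \<in> carrier P \<Longrightarrow> g (u x) = h x"
    by metis
  define k where "k = (\<lambda>x\<in>carrier P. finprod M u (un (s x)))"
  have s_un: "un (s x) \<subseteq> carrier P" "s x = code_set (un (s x))" if "x \<in> carrier P" for x
    using semimod_homD(1)[OF s(1) that] by (auto simp: F_simps un)
  have "k \<in> semimod_hom P M"
  proof (rule semimod_homI)
    show "k x \<in> carrier M" if "x \<in> carrier P" for x
      using that s_un(1)[OF that] u(1) by (auto simp: k_def intro!: M.finprod_closed)
    show "k (x \<otimes>\<^bsub>P\<^esub> y) = k x \<otimes>\<^bsub>M\<^esub> k y" if xy: "x \<in> carrier P" "y \<in> carrier P" for x y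
    proof -
      have "un (s (x \<otimes>\<^bsub>P\<^esub> y)) = un (s x) \<union> un (s y)"
        using semimod_homD(2)[OF s(1) xy] s_un(1) xy by (simp add: F_simps un)
      moreover have "finprod M u (un (s x) \<union> un (s y)) =
          finprod M u (un (s x)) \<otimes>\<^bsub>M\<^esub> finprod M u (un (s y))"
        using s_un(1)[OF xy(1)] s_un(1)[OF xy(2)] fin u(1) by (intro M.finprod_Un) auto
      ultimately show ?thesis using xy by (simp add: k_def)
    qed
    show "k \<one>\<^bsub>P\<^esub> = \<one>\<^bsub>M\<^esub>" using semimod_homD(3)[OF s(1)] by (simp add: k_def F_simps un)
  qed (simp add: k_def)
  moreover have "compose (carrier P) g k = h"
  proof (rule extensionalityI)
    show "compose (carrier P) g k \<in> extensional (carrier P)" by simp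
    show "h \<in> extensional (carrier P)" using h semimod_homD(4) by blast
    fix x assume x: "x \<in> carrier P"
    have U: "un (s x) \<subseteq> carrier P" "finite (un (s x))" using s_un(1)[OF x] fin by auto
    have "g (finprod M u (un (s x))) = finprod N (\<lambda>y. g (u y)) (un (s x))"
      using U u(1) by (intro semimod_hom_finprod M N g) auto
    also have "\<dots> = finprod N (\<lambda>y. h y) (un (s x))"
    proof (rule N.finprod_cong')
      show "(\<lambda>y. h y) \<in> un (s x) \<rightarrow> carrier N" using U semimod_homD(1)[OF h] by blast
    qed (use U u(2) in auto)
    also have "\<dots> = h (finprod P (\<lambda>y. y) (un (s x)))"
      using U
      by (intro semimod_hom_finprod[OF P.boolean_semimodule_axioms N h, symmetric]) auto
    also have "finprod P (\<lambda>y. y) (un (s x)) = x"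
      using \<pi>s[OF x] semimod_homD(1)[OF s(1) x] by (simp add: \<pi>_def)
    finally show "compose (carrier P) g k x = h x" using x by (simp add: compose_def k_def)
  qed
  ultimately show ?thesis by blast
qed

end

(*
  Homomorphisms out of a tensor product are determined by their values on pure tensors, so every
  coherence law is an equation between pure tensors.

  A finite semimodule P is projective iff the surjection from a finite free semimodule splits, that
  is iff P has a dual basis: elements e a and coordinates phi_a = (x |-> [a : s x]), for a in a
  finite set A, with x = Sum_a phi_a(x) e a and s additive. Dual bases pass to tensor products, and
  exchanging the roles of e and phi gives a dual basis of P*. The coevaluation sends 1 to
  Sum_a e a (x) phi_a, and the two zigzag identities are the expansions of x in P and of phi in P*
  in these bases.
*)

theory Submission
  imports Defs
begin


section \<open>Homomorphisms of finite semimodules\<close>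

text \<open>Three obstacles shape the proof. Projectivity is tested only on semimodules inside the
  universe, whereas the free semimodule on \<open>A\<close> is \<open>Pow A\<close>, over a type of
  sets; \<open>projective_lifts\<close> bridges the gap. The zigzag identities contain inverses of
  structure maps through the definite description \<open>inv_arrow\<close>, so knowing that these
  maps are invertible is not enough: their inverses have to be known on pure tensors. The associator
  must be linear in a variable that its inner lift holds fixed, and this linearity needs an argument
  of its own. Over the Boolean semiring a functional is known by the set where it takes the value 1.
  Hence a family of functionals indexed by \<open>A\<close> is one additive map into
  \<open>Pow A\<close>: coefficients become membership, and scaling becomes the selection of
  summands.\<close>

definition fin_semimod :: "'a monoid \<Rightarrow> bool" where
  "fin_semimod M \<longleftrightarrow> boolean_semimodule M \<and> finite (carrier M)"

lemma fin_semimodD: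
  assumes "fin_semimod M"
  shows "boolean_semimodule M" "comm_monoid M" "monoid M" "finite (carrier M)"
  using assms by (auto simp: fin_semimod_def boolean_semimodule_def comm_monoid_def)

lemma fin_semimodI: "\<lbrakk>boolean_semimodule M; finite (carrier M)\<rbrakk> \<Longrightarrow> fin_semimod M"
  by (simp add: fin_semimod_def)

lemma fin_semimod_closed [simp]:
  assumes "fin_semimod M"
  shows "\<one>\<^bsub>M\<^esub> \<in> carrier M"
    and "\<lbrakk>x \<in> carrier M; y \<in> carrier M\<rbrakk> \<Longrightarrow> x \<otimes>\<^bsub>M\<^esub> y \<in> carrier M"
    and "x \<in> carrier M \<Longrightarrow> \<one>\<^bsub>M\<^esub> \<otimes>\<^bsub>M\<^esub> x = x"
    and "x \<in> carrier M \<Longrightarrow> x \<otimes>\<^bsub>M\<^esub> \<one>\<^bsub>M\<^esub> = x"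
  using fin_semimodD(3)[OF assms]
  by (auto simp: monoid.one_closed monoid.m_closed monoid.l_one monoid.r_one)

text \<open>This law makes a pointwise sum of two additive maps additive. It serves the associator,
  where a sum in the third factor meets a sum in the tensor product of the first two.\<close>

lemma add_interchange:
  assumes "boolean_semimodule M" "a \<in> carrier M" "b \<in> carrier M" "c \<in> carrier M" "d \<in> carrier M"
  shows "(a \<otimes>\<^bsub>M\<^esub> b) \<otimes>\<^bsub>M\<^esub> (c \<otimes>\<^bsub>M\<^esub> d) = (a \<otimes>\<^bsub>M\<^esub> c) \<otimes>\<^bsub>M\<^esub> (b \<otimes>\<^bsub>M\<^esub> d)"
proof -
  interpret boolean_semimodule M by fact
  show ?thesis using assms by (simp add: m_ac)
qed

lemma semimod_hom_id: "monoid M \<Longrightarrow> (\<lambda>x\<in>carrier M. x) \<in> semimod_hom M M"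
  by (rule semimod_homI) (auto simp: monoid.one_closed monoid.m_closed)

lemma semimod_hom_compose:
  assumes "monoid L" "f \<in> semimod_hom L M" "g \<in> semimod_hom M N"
  shows "compose (carrier L) g f \<in> semimod_hom L N"
  by (rule semimod_homI)
    (auto simp: compose_def assms semimod_homD[OF assms(2)] semimod_homD[OF assms(3)]
      monoid.one_closed monoid.m_closed)

lemma semimod_hom_eqI:
  assumes "f \<in> semimod_hom M N" "g \<in> semimod_hom M N" "\<And>x. x \<in> carrier M \<Longrightarrow> f x = g x"
  shows "f = g"
  using assms semimod_homD(4) by (blast intro: extensionalityI)

lemma bilinearI:
  assumes "monoid M" "monoid N"
    and "\<And>x y. \<lbrakk>x \<in> carrier M; y \<in> carrier N\<rbrakk> \<Longrightarrow> f x y \<in> carrier K"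
    and "\<And>x x' y. \<lbrakk>x \<in> carrier M; x' \<in> carrier M; y \<in> carrier N\<rbrakk>
        \<Longrightarrow> f (x \<otimes>\<^bsub>M\<^esub> x') y = f x y \<otimes>\<^bsub>K\<^esub> f x' y"
    and "\<And>x y y'. \<lbrakk>x \<in> carrier M; y \<in> carrier N; y' \<in> carrier N\<rbrakk>
        \<Longrightarrow> f x (y \<otimes>\<^bsub>N\<^esub> y') = f x y \<otimes>\<^bsub>K\<^esub> f x y'"
    and "\<And>y. y \<in> carrier N \<Longrightarrow> f \<one>\<^bsub>M\<^esub> y = \<one>\<^bsub>K\<^esub>"
    and "\<And>x. x \<in> carrier M \<Longrightarrow> f x \<one>\<^bsub>N\<^esub> = \<one>\<^bsub>K\<^esub>"
  shows "bilinear M N K f"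
  unfolding bilinear_def
  using assms by (auto intro!: semimod_homI simp: monoid.one_closed monoid.m_closed)

section \<open>Homomorphisms out of tensor products\<close>

lemma finite_pairI: "\<lbrakk>fin_semimod M; fin_semimod N\<rbrakk> \<Longrightarrow> finite_pair M N"
  by (simp add: finite_pair_def fin_semimodD)

text \<open>With one predicate per object instead of one per pair, finiteness passes through nested
  tensor products of any depth.\<close>

lemma fin_semimod_tensor [simp]: "\<lbrakk>fin_semimod M; fin_semimod N\<rbrakk> \<Longrightarrow> fin_semimod (tensor M N)"
  by (simp add: fin_semimodI finite_pair.tensor_semimodule finite_pair.finite_tensor finite_pairI)

lemma pure_tensor_closed [simp]:
  "\<lbrakk>fin_semimod M; fin_semimod N; x \<in> carrier M; y \<in> carrier N\<rbrakk>
    \<Longrightarrow> pure_tensor M N x y \<in> carrier (tensor M N)"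
  by (simp add: finite_pair.pure_closed finite_pairI)

lemma
  assumes "fin_semimod M" "fin_semimod N"
  shows pure_tensor_add_left: "\<lbrakk>x \<in> carrier M; x' \<in> carrier M; y \<in> carrier N\<rbrakk>
      \<Longrightarrow> pure_tensor M N (x \<otimes>\<^bsub>M\<^esub> x') y =
        pure_tensor M N x y \<otimes>\<^bsub>tensor M N\<^esub> pure_tensor M N x' y"
    and pure_tensor_add_right: "\<lbrakk>x \<in> carrier M; y \<in> carrier N; y' \<in> carrier N\<rbrakk>
      \<Longrightarrow> pure_tensor M N x (y \<otimes>\<^bsub>N\<^esub> y') =
        pure_tensor M N x y \<otimes>\<^bsub>tensor M N\<^esub> pure_tensor M N x y'"
    and pure_tensor_zero_left: "y \<in> carrier N \<Longrightarrow> pure_tensor M N \<one>\<^bsub>M\<^esub> y = \<one>\<^bsub>tensor M N\<^esub>"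
    and pure_tensor_zero_right: "x \<in> carrier M \<Longrightarrow> pure_tensor M N x \<one>\<^bsub>N\<^esub> = \<one>\<^bsub>tensor M N\<^esub>"
  using bilinearD[OF finite_pair.pure_bilinear[OF finite_pairI[OF assms]]
      fin_semimodD(3)[OF assms(1)] fin_semimodD(3)[OF assms(2)]]
  by auto

lemmas pure_tensor_bilinear = pure_tensor_add_left pure_tensor_add_right
  pure_tensor_zero_left pure_tensor_zero_right

text \<open>The class of a formal sum is the sum of its pure tensors by
  \<open>tensor_class_sum\<close>, so the induction runs over the finite set of summands.\<close>

lemma tensor_induct [consumes 3, case_names zero pure add]:
  assumes "fin_semimod M" "fin_semimod N" "c \<in> carrier (tensor M N)"
    and "P \<one>\<^bsub>tensor M N\<^esub>"
    and "\<And>x y. \<lbrakk>x \<in> carrier M; y \<in> carrier N\<rbrakk> \<Longrightarrow> P (pure_tensor M N x y)"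
    and "\<And>c d. \<lbrakk>c \<in> carrier (tensor M N); d \<in> carrier (tensor M N); P c; P d\<rbrakk>
        \<Longrightarrow> P (c \<otimes>\<^bsub>tensor M N\<^esub> d)"
  shows "P c"
proof -
  interpret finite_pair M N by (rule finite_pairI) fact+
  interpret T: boolean_semimodule "tensor M N" by (rule tensor_semimodule)
  obtain S where S: "S \<in> formal_sums M N" "c = tensor_class M N S"
    using assms(3) by (rule tensor_cases)
  have "finite S" "S \<subseteq> carrier M \<times> carrier N" using S by (auto simp: formal_sums_def)
  then have "P (finprod (tensor M N) (case_prod (pure_tensor M N)) S)"
  proof (induction S rule: finite_induct)
    case empty
    then show ?case using assms(4) by simp
  next
    case (insert p S)
    then have "case_prod (pure_tensor M N) \<in> S \<rightarrow> carrier (tensor M N)"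
      by (auto intro!: pure_closed)
    moreover obtain x y where "p = (x, y)" "x \<in> carrier M" "y \<in> carrier N"
      using insert.prems by auto
    ultimately show ?case using insert assms(5,6) by (auto simp: T.finprod_closed pure_closed)
  qed
  then show ?thesis using S tensor_class_sum by simp
qed

lemma tensor_lift_hom':
  "\<lbrakk>fin_semimod M; fin_semimod N; boolean_semimodule K; bilinear M N K f\<rbrakk>
    \<Longrightarrow> tensor_lift M N K f \<in> semimod_hom (tensor M N) K"
  by (simp add: finite_pair.tensor_lift_hom finite_pairI)

lemma tensor_lift_pure':
  "\<lbrakk>fin_semimod M; fin_semimod N; boolean_semimodule K; bilinear M N K f;
    x \<in> carrier M; y \<in> carrier N\<rbrakk>
    \<Longrightarrow> tensor_lift M N K f (pure_tensor M N x y) = f x y"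
  by (simp add: finite_pair.tensor_lift_pure finite_pairI)

lemma tensor_hom_eqI:
  assumes M: "fin_semimod M" "fin_semimod N"
    and f: "f \<in> semimod_hom (tensor M N) K" and g: "g \<in> semimod_hom (tensor M N) K"
    and eq: "\<And>x y. \<lbrakk>x \<in> carrier M; y \<in> carrier N\<rbrakk>
      \<Longrightarrow> f (pure_tensor M N x y) = g (pure_tensor M N x y)"
  shows "f = g"
  using f g
proof (rule semimod_hom_eqI)
  fix c assume "c \<in> carrier (tensor M N)"
  with M show "f c = g c"
    by (induction c rule: tensor_induct) (simp_all add: semimod_homD[OF f] semimod_homD[OF g] eq)
qed

lemma pure_tensor_hom_left:
  assumes "fin_semimod M" "fin_semimod N" "y \<in> carrier N"
  shows "(\<lambda>x\<in>carrier M. pure_tensor M N x y) \<in> semimod_hom M (tensor M N)"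
  using assms by (intro semimod_homI) (simp_all add: pure_tensor_bilinear)

lemma pure_tensor_hom_right:
  assumes "fin_semimod M" "fin_semimod N" "x \<in> carrier M"
  shows "(\<lambda>y\<in>carrier N. pure_tensor M N x y) \<in> semimod_hom N (tensor M N)"
  using assms by (intro semimod_homI) (simp_all add: pure_tensor_bilinear)

text \<open>For fixed \<open>z\<close>, the elements \<open>c\<close> at which the two maps agree
  after tensoring with \<open>z\<close> include zero and the pure tensors and are closed under sums,
  because \<open>pure_tensor\<close> is additive in \<open>c\<close>.\<close>

lemma tensor_hom_eqI3:
  assumes M: "fin_semimod M" "fin_semimod N" "fin_semimod K"
    and f: "f \<in> semimod_hom (tensor (tensor M N) K) L"
    and g: "g \<in> semimod_hom (tensor (tensor M N) K) L"
    and eq: "\<And>x y z. \<lbrakk>x \<in> carrier M; y \<in> carrier N; z \<in> carrier K\<rbrakk>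
      \<Longrightarrow> f (pure_tensor (tensor M N) K (pure_tensor M N x y) z) =
        g (pure_tensor (tensor M N) K (pure_tensor M N x y) z)"
  shows "f = g"
proof (rule tensor_hom_eqI[OF _ _ f g])
  fix c z assume "c \<in> carrier (tensor M N)" and z: "z \<in> carrier K"
  with M(1,2) show "f (pure_tensor (tensor M N) K c z) = g (pure_tensor (tensor M N) K c z)"
    using M
    by (induction c rule: tensor_induct)
      (simp_all add: eq pure_tensor_bilinear semimod_homD[OF f] semimod_homD[OF g])
qed (use M in simp_all)

lemma tensor_hom_eqI3':
  assumes M: "fin_semimod M" "fin_semimod N" "fin_semimod K"
    and f: "f \<in> semimod_hom (tensor M (tensor N K)) L"
    and g: "g \<in> semimod_hom (tensor M (tensor N K)) L"
    and eq: "\<And>x y z. \<lbrakk>x \<in> carrier M; y \<in> carrier N; z \<in> carrier K\<rbrakk>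
      \<Longrightarrow> f (pure_tensor M (tensor N K) x (pure_tensor N K y z)) =
        g (pure_tensor M (tensor N K) x (pure_tensor N K y z))"
  shows "f = g"
proof (rule tensor_hom_eqI[OF _ _ f g])
  fix x c assume x: "x \<in> carrier M" and c: "c \<in> carrier (tensor N K)"
  from M(2,3) c show "f (pure_tensor M (tensor N K) x c) = g (pure_tensor M (tensor N K) x c)"
    using M x
    by (induction c rule: tensor_induct)
      (simp_all add: eq pure_tensor_bilinear semimod_homD[OF f] semimod_homD[OF g])
qed (use M in simp_all)

text \<open>\<open>tensor_hom_eqI3\<close> with first factor \<open>tensor M N\<close> leaves one
  more induction inside that factor. The pentagon needs this depth.\<close>

lemma tensor_hom_eqI4:
  assumes M: "fin_semimod M" "fin_semimod N" "fin_semimod K" "fin_semimod L"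
    and f: "f \<in> semimod_hom (tensor (tensor (tensor M N) K) L) Q"
    and g: "g \<in> semimod_hom (tensor (tensor (tensor M N) K) L) Q"
    and eq: "\<And>x y z w. \<lbrakk>x \<in> carrier M; y \<in> carrier N; z \<in> carrier K; w \<in> carrier L\<rbrakk>
      \<Longrightarrow> f (pure_tensor (tensor (tensor M N) K) L
            (pure_tensor (tensor M N) K (pure_tensor M N x y) z) w) =
        g (pure_tensor (tensor (tensor M N) K) L
            (pure_tensor (tensor M N) K (pure_tensor M N x y) z) w)"
  shows "f = g"
proof (rule tensor_hom_eqI3[OF _ _ _ f g])
  fix c z w assume "c \<in> carrier (tensor M N)" and z: "z \<in> carrier K" and w: "w \<in> carrier L"
  with M(1,2) show "f (pure_tensor (tensor (tensor M N) K) L (pure_tensor (tensor M N) K c z) w) =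
      g (pure_tensor (tensor (tensor M N) K) L (pure_tensor (tensor M N) K c z) w)"
    using M
    by (induction c rule: tensor_induct)
      (simp_all add: eq pure_tensor_bilinear semimod_homD[OF f] semimod_homD[OF g])
qed (use M in simp_all)


section \<open>The structure maps\<close>

lemma boole_simps [simp]:
  "carrier boole = range VBool"
  "\<one>\<^bsub>boole\<^esub> = VBool False"
  "VBool a \<otimes>\<^bsub>boole\<^esub> VBool b = VBool (a \<or> b)"
  by (auto simp: boole_def)

lemma fin_semimod_boole [simp]: "fin_semimod boole"
  by (rule fin_semimodI, unfold_locales) auto

text \<open>The functions inside the arrows get names of their own, so that coherence laws become
  equations of functions. The carriers are arguments because a HOL function records neither its
  source nor its target.\<close>

definition tensor_map ::
    "'a univ monoid \<Rightarrow> 'a univ monoid \<Rightarrow> 'a univ monoid \<Rightarrow> 'a univ monoid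
      \<Rightarrow> ('a univ \<Rightarrow> 'a univ) \<Rightarrow> ('a univ \<Rightarrow> 'a univ) \<Rightarrow> 'a univ \<Rightarrow> 'a univ" where
  "tensor_map M N M' N' f g =
     tensor_lift M N (tensor M' N') (\<lambda>x y. pure_tensor M' N' (f x) (g y))"

definition assoc_map ::
    "'a univ monoid \<Rightarrow> 'a univ monoid \<Rightarrow> 'a univ monoid \<Rightarrow> 'a univ \<Rightarrow> 'a univ" where
  "assoc_map M N K = tensor_lift (tensor M N) K (tensor M (tensor N K))
     (\<lambda>t z. tensor_lift M N (tensor M (tensor N K))
       (\<lambda>x y. pure_tensor M (tensor N K) x (pure_tensor N K y z)) t)"

definition lunit_map :: "'a univ monoid \<Rightarrow> 'a univ \<Rightarrow> 'a univ" where
  "lunit_map M = tensor_lift boole M M (\<lambda>b x. if b = VBool True then x else \<one>\<^bsub>M\<^esub>)"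

definition runit_map :: "'a univ monoid \<Rightarrow> 'a univ \<Rightarrow> 'a univ" where
  "runit_map M = tensor_lift M boole M (\<lambda>x b. if b = VBool True then x else \<one>\<^bsub>M\<^esub>)"

definition swap_map :: "'a univ monoid \<Rightarrow> 'a univ monoid \<Rightarrow> 'a univ \<Rightarrow> 'a univ" where
  "swap_map M N = tensor_lift M N (tensor N M) (\<lambda>x y. pure_tensor N M y x)"

lemma
  assumes "fin_semimod M" "fin_semimod N" "fin_semimod M'" "fin_semimod N'"
    and f: "f \<in> semimod_hom M M'" and g: "g \<in> semimod_hom N N'"
  shows tensor_map_hom: "tensor_map M N M' N' f g \<in> semimod_hom (tensor M N) (tensor M' N')"
    and tensor_map_pure: "\<lbrakk>x \<in> carrier M; y \<in> carrier N\<rbrakk>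
      \<Longrightarrow> tensor_map M N M' N' f g (pure_tensor M N x y) = pure_tensor M' N' (f x) (g y)"
proof -
  have "bilinear M N (tensor M' N') (\<lambda>x y. pure_tensor M' N' (f x) (g y))"
    using assms
    by (intro bilinearI)
      (simp_all add: fin_semimodD semimod_homD[OF f] semimod_homD[OF g] pure_tensor_bilinear)
  then show "tensor_map M N M' N' f g \<in> semimod_hom (tensor M N) (tensor M' N')"
    "\<lbrakk>x \<in> carrier M; y \<in> carrier N\<rbrakk>
      \<Longrightarrow> tensor_map M N M' N' f g (pure_tensor M N x y) = pure_tensor M' N' (f x) (g y)"
    using assms unfolding tensor_map_def
    by (simp_all add: fin_semimodD tensor_lift_hom' tensor_lift_pure')
qed

text \<open>For fixed \<open>z\<close> the inner lift \<open>?F z\<close> is additive in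
  \<open>t\<close> by construction. Its additivity in \<open>z\<close> is visible only at pure
  tensors and is extended to all \<open>t\<close> by induction; then the outer lift exists.\<close>

lemma
  assumes M: "fin_semimod M" "fin_semimod N" "fin_semimod K"
  shows assoc_map_hom: "assoc_map M N K \<in> semimod_hom (tensor (tensor M N) K) (tensor M (tensor N K))"
    and assoc_map_pure: "\<lbrakk>x \<in> carrier M; y \<in> carrier N; z \<in> carrier K\<rbrakk>
      \<Longrightarrow> assoc_map M N K (pure_tensor (tensor M N) K (pure_tensor M N x y) z) =
        pure_tensor M (tensor N K) x (pure_tensor N K y z)"
proof -
  let ?T = "tensor M (tensor N K)"
  let ?F = "\<lambda>z. tensor_lift M N ?T (\<lambda>x y. pure_tensor M (tensor N K) x (pure_tensor N K y z))"
  have b: "bilinear M N ?T (\<lambda>x y. pure_tensor M (tensor N K) x (pure_tensor N K y z))"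
    if "z \<in> carrier K" for z
    using M that by (intro bilinearI) (simp_all add: fin_semimodD pure_tensor_bilinear)
  have T: "boolean_semimodule ?T" using M by (simp add: fin_semimodD)
  have F: "?F z \<in> semimod_hom (tensor M N) ?T" if "z \<in> carrier K" for z
    using M b[OF that] T by (simp add: tensor_lift_hom')
  have F_pure: "?F z (pure_tensor M N x y) = pure_tensor M (tensor N K) x (pure_tensor N K y z)"
    if "x \<in> carrier M" "y \<in> carrier N" "z \<in> carrier K" for x y z
    using M b[OF that(3)] that T by (simp add: tensor_lift_pure')
  note FD = semimod_homD[OF F]
  \<comment> \<open>At \<open>t = c + d\<close> the four summands appear in two groupings, which
    \<open>add_interchange\<close> identifies.\<close>
  have add: "?F (z \<otimes>\<^bsub>K\<^esub> z') t = ?F z t \<otimes>\<^bsub>?T\<^esub> ?F z' t"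
    if "t \<in> carrier (tensor M N)" "z \<in> carrier K" "z' \<in> carrier K" for t z z'
    using M(1,2) that(1)
  proof (induction t rule: tensor_induct)
    case (add c d)
    then show ?case using M that by (simp add: FD add_interchange[OF T])
  qed (use M that in \<open>simp_all add: FD F_pure pure_tensor_bilinear\<close>)
  have zero: "?F \<one>\<^bsub>K\<^esub> t = \<one>\<^bsub>?T\<^esub>" if "t \<in> carrier (tensor M N)" for t
    using M(1,2) that
    by (induction t rule: tensor_induct) (use M in \<open>simp_all add: FD F_pure pure_tensor_bilinear\<close>)
  have B: "bilinear (tensor M N) K ?T (\<lambda>t z. ?F z t)"
    using M by (intro bilinearI) (simp_all add: fin_semimodD FD add zero)
  then show "assoc_map M N K \<in> semimod_hom (tensor (tensor M N) K) ?T"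
    "\<lbrakk>x \<in> carrier M; y \<in> carrier N; z \<in> carrier K\<rbrakk>
      \<Longrightarrow> assoc_map M N K (pure_tensor (tensor M N) K (pure_tensor M N x y) z) =
        pure_tensor M (tensor N K) x (pure_tensor N K y z)"
    using M T unfolding assoc_map_def by (simp_all add: tensor_lift_hom' tensor_lift_pure' F_pure)
qed

lemma
  fixes M :: "'a univ monoid"
  assumes "fin_semimod M"
  shows lunit_map_hom: "lunit_map M \<in> semimod_hom (tensor boole M) M"
    and lunit_map_pure: "x \<in> carrier M
      \<Longrightarrow> lunit_map M (pure_tensor boole M (VBool b) x) = (if b then x else \<one>\<^bsub>M\<^esub>)"
proof -
  interpret boolean_semimodule M using assms fin_semimodD by blast
  \<comment> \<open>Additivity in the scalar at 1 + 1 = 1 demands x = x + x, which is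
    idempotence.\<close>
  have b: "bilinear (boole :: 'a univ monoid) M M (\<lambda>b x. if b = VBool True then x else \<one>\<^bsub>M\<^esub>)"
    using assms by (intro bilinearI) (auto simp: fin_semimodD idem)
  note rules = fin_semimod_boole assms  boolean_semimodule_axioms b
  show "lunit_map M \<in> semimod_hom (tensor boole M) M"
    unfolding lunit_map_def by (rule tensor_lift_hom'[OF rules])
  show "x \<in> carrier M \<Longrightarrow> lunit_map M (pure_tensor boole M (VBool b) x) = (if b then x else \<one>\<^bsub>M\<^esub>)"
    unfolding lunit_map_def by (subst tensor_lift_pure'[OF rules]) simp_all
qed

lemma
  fixes M :: "'a univ monoid"
  assumes "fin_semimod M"
  shows runit_map_hom: "runit_map M \<in> semimod_hom (tensor M boole) M"
    and runit_map_pure: "x \<in> carrier M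
      \<Longrightarrow> runit_map M (pure_tensor M boole x (VBool b)) = (if b then x else \<one>\<^bsub>M\<^esub>)"
proof -
  interpret boolean_semimodule M using assms fin_semimodD by blast
  have b: "bilinear M (boole :: 'a univ monoid) M (\<lambda>x b. if b = VBool True then x else \<one>\<^bsub>M\<^esub>)"
    using assms by (intro bilinearI) (auto simp: fin_semimodD idem)
  note rules = assms fin_semimod_boole  boolean_semimodule_axioms b
  show "runit_map M \<in> semimod_hom (tensor M boole) M"
    unfolding runit_map_def by (rule tensor_lift_hom'[OF rules])
  show "x \<in> carrier M \<Longrightarrow> runit_map M (pure_tensor M boole x (VBool b)) = (if b then x else \<one>\<^bsub>M\<^esub>)"
    unfolding runit_map_def by (subst tensor_lift_pure'[OF rules]) simp_all
qed

lemma
  assumes "fin_semimod M" "fin_semimod N"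
  shows swap_map_hom: "swap_map M N \<in> semimod_hom (tensor M N) (tensor N M)"
    and swap_map_pure: "\<lbrakk>x \<in> carrier M; y \<in> carrier N\<rbrakk>
      \<Longrightarrow> swap_map M N (pure_tensor M N x y) = pure_tensor N M y x"
proof -
  have "bilinear M N (tensor N M) (\<lambda>x y. pure_tensor N M y x)"
    using assms by (intro bilinearI) (simp_all add: fin_semimodD pure_tensor_bilinear)
  then show "swap_map M N \<in> semimod_hom (tensor M N) (tensor N M)"
    "\<lbrakk>x \<in> carrier M; y \<in> carrier N\<rbrakk>
      \<Longrightarrow> swap_map M N (pure_tensor M N x y) = pure_tensor N M y x"
    using assms unfolding swap_map_def
    by (simp_all add: fin_semimodD tensor_lift_hom' tensor_lift_pure')
qed

text \<open>
  Going from \<open>x(yz)\<close> to \<open>(xy)z\<close> along \<open>(yz)x\<close>, \<open>(zy)x\<close>, \<open>z(yx)\<close> and \<open>(yx)z\<close> spares a second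
  nested bilinear lift.
\<close>

definition assoc_inv_map ::
    "'a univ monoid \<Rightarrow> 'a univ monoid \<Rightarrow> 'a univ monoid \<Rightarrow> 'a univ \<Rightarrow> 'a univ" where
  "assoc_inv_map M N K =
     (let T = tensor M (tensor N K); i = (\<lambda>M. \<lambda>x\<in>carrier M. x) in
      compose (carrier T) (tensor_map (tensor N M) K (tensor M N) K (swap_map N M) (i K))
     (compose (carrier T) (swap_map K (tensor N M))
     (compose (carrier T) (assoc_map K N M)
     (compose (carrier T) (tensor_map (tensor N K) M (tensor K N) M (swap_map N K) (i M))
       (swap_map M (tensor N K))))))"

lemma
  assumes M: "fin_semimod M" "fin_semimod N" "fin_semimod K"
  shows assoc_inv_map_hom:
      "assoc_inv_map M N K \<in> semimod_hom (tensor M (tensor N K)) (tensor (tensor M N) K)"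
    and assoc_inv_map_pure: "\<lbrakk>x \<in> carrier M; y \<in> carrier N; z \<in> carrier K\<rbrakk>
      \<Longrightarrow> assoc_inv_map M N K (pure_tensor M (tensor N K) x (pure_tensor N K y z)) =
        pure_tensor (tensor M N) K (pure_tensor M N x y) z"
proof -
  show "assoc_inv_map M N K \<in> semimod_hom (tensor M (tensor N K)) (tensor (tensor M N) K)"
    unfolding assoc_inv_map_def Let_def
    by (rule semimod_hom_compose tensor_map_hom swap_map_hom assoc_map_hom semimod_hom_id
        | simp add: fin_semimodD M)+
  show "\<lbrakk>x \<in> carrier M; y \<in> carrier N; z \<in> carrier K\<rbrakk>
      \<Longrightarrow> assoc_inv_map M N K (pure_tensor M (tensor N K) x (pure_tensor N K y z)) =
        pure_tensor (tensor M N) K (pure_tensor M N x y) z"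
    using M by (simp add: assoc_inv_map_def Let_def compose_eq swap_map_pure assoc_map_pure
        tensor_map_pure swap_map_hom semimod_hom_id fin_semimodD)
qed

section \<open>The symmetric monoidal category of finite semimodules\<close>

lemma finite_semimodules_simps:
  "Obj finite_semimodules = {M. fin_semimod M}"
  "Dom finite_semimodules = src"
  "Cod finite_semimodules = tgt"
  "Ident finite_semimodules M = Arrow M M (\<lambda>x\<in>carrier M. x)"
  "g \<cdot>\<^bsub>finite_semimodules\<^esub> f =
     Arrow (src f) (tgt g) (compose (carrier (src f)) (fun_of g) (fun_of f))"
  "Unit finite_semimodules = boole"
  "TenO finite_semimodules = tensor"
  "f \<boxtimes>\<^bsub>finite_semimodules\<^esub> g = Arrow (tensor (src f) (src g)) (tensor (tgt f) (tgt g))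
     (tensor_map (src f) (src g) (tgt f) (tgt g) (fun_of f) (fun_of g))"
  "Associator finite_semimodules M N K =
     Arrow (tensor (tensor M N) K) (tensor M (tensor N K)) (assoc_map M N K)"
  "LUnitor finite_semimodules M = Arrow (tensor boole M) M (lunit_map M)"
  "RUnitor finite_semimodules M = Arrow (tensor M boole) M (runit_map M)"
  "Braiding finite_semimodules M N = Arrow (tensor M N) (tensor N M) (swap_map M N)"
  by (simp_all add: finite_semimodules_def fin_semimod_def tensor_map_def assoc_map_def
      lunit_map_def runit_map_def swap_map_def)

lemma Arr_finite_semimodules:
  "Arrow M N f \<in> Arr finite_semimodules \<longleftrightarrow>
    fin_semimod M \<and> fin_semimod N \<and> f \<in> semimod_hom M N"
  by (auto simp: finite_semimodules_def fin_semimod_def)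

lemma Homset_finite_semimodules:
  "a \<in> Homset finite_semimodules M N \<longleftrightarrow>
    (\<exists>f. a = Arrow M N f \<and> fin_semimod M \<and> fin_semimod N \<and> f \<in> semimod_hom M N)"
  by (cases a) (auto simp: Homset_def finite_semimodules_simps Arr_finite_semimodules)

lemma Homset_cases:
  assumes "a \<in> Homset finite_semimodules M N"
  obtains f where "a = Arrow M N f" "fin_semimod M" "fin_semimod N" "f \<in> semimod_hom M N"
  using assms by (auto simp: Homset_finite_semimodules)

section \<open>Explicit inverses of the associator and the unitors\<close>

lemma inverse_arrowsI:
  assumes "fin_semimod M" "fin_semimod N" "f \<in> semimod_hom M N" "g \<in> semimod_hom N M"
    "compose (carrier M) g f = (\<lambda>x\<in>carrier M. x)" "compose (carrier N) f g = (\<lambda>x\<in>carrier N. x)"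
  shows "inverse_arrows finite_semimodules (Arrow M N f) (Arrow N M g)"
  using assms
  by (simp add: inverse_arrows_def Arr_finite_semimodules Homset_finite_semimodules
      finite_semimodules_simps)

lemma inverse_arrows_assoc:
  assumes M: "fin_semimod M" "fin_semimod N" "fin_semimod K"
  shows "inverse_arrows finite_semimodules (Associator finite_semimodules M N K)
    (Arrow (tensor M (tensor N K)) (tensor (tensor M N) K) (assoc_inv_map M N K))"
  unfolding finite_semimodules_simps
proof (rule inverse_arrowsI)
  show "compose (carrier (tensor (tensor M N) K)) (assoc_inv_map M N K) (assoc_map M N K) =
      (\<lambda>x\<in>carrier (tensor (tensor M N) K). x)"
    by (rule tensor_hom_eqI3[OF M], rule semimod_hom_compose[OF _ assoc_map_hom assoc_inv_map_hom])
      (use M in \<open>simp_all add: fin_semimodD semimod_hom_id compose_eq assoc_map_pure assoc_inv_map_pure\<close>)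
  show "compose (carrier (tensor M (tensor N K))) (assoc_map M N K) (assoc_inv_map M N K) =
      (\<lambda>x\<in>carrier (tensor M (tensor N K)). x)"
    by (rule tensor_hom_eqI3'[OF M], rule semimod_hom_compose[OF _ assoc_inv_map_hom assoc_map_hom])
      (use M in \<open>simp_all add: fin_semimodD semimod_hom_id compose_eq assoc_map_pure assoc_inv_map_pure\<close>)
qed (use M in \<open>simp_all add: assoc_map_hom assoc_inv_map_hom\<close>)

lemma pure_tensor_False:
  assumes "fin_semimod M" "x \<in> carrier M"
  shows "pure_tensor boole M (VBool False) x = \<one>\<^bsub>tensor boole M\<^esub>"
    and "pure_tensor M boole x (VBool False) = \<one>\<^bsub>tensor M boole\<^esub>"
  using assms pure_tensor_zero_left[of boole M x] pure_tensor_zero_right[of M boole x] by simp_all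

lemma inverse_arrows_lunit:
  assumes M: "fin_semimod M"
  shows "inverse_arrows finite_semimodules (LUnitor finite_semimodules M)
    (Arrow M (tensor boole M) (\<lambda>x\<in>carrier M. pure_tensor boole M (VBool True) x))"
  unfolding finite_semimodules_simps
proof (rule inverse_arrowsI)
  let ?g = "\<lambda>x\<in>carrier M. pure_tensor boole M (VBool True) x"
  show g: "?g \<in> semimod_hom M (tensor boole M)"
    using M by (intro pure_tensor_hom_right) simp_all
  \<comment> \<open>The pure tensor of b and x goes to that of 1 and bx. For b = 1 nothing changes;
    for b = 0 both are zero, one through its left factor and the other through its right
    factor.\<close>
  show "compose (carrier (tensor boole M)) ?g (lunit_map M) = (\<lambda>x\<in>carrier (tensor boole M). x)"
    by (rule tensor_hom_eqI[OF fin_semimod_boole M semimod_hom_compose[OF _ lunit_map_hom g]])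
      (use M in \<open>auto simp: fin_semimodD semimod_hom_id compose_eq lunit_map_pure
        pure_tensor_False pure_tensor_zero_right split: if_splits\<close>)
  show "compose (carrier M) (lunit_map M) ?g = (\<lambda>x\<in>carrier M. x)"
    using M by (auto simp: compose_def lunit_map_pure)
qed (use M in \<open>simp_all add: lunit_map_hom\<close>)

lemma inverse_arrows_runit:
  assumes M: "fin_semimod M"
  shows "inverse_arrows finite_semimodules (RUnitor finite_semimodules M)
    (Arrow M (tensor M boole) (\<lambda>x\<in>carrier M. pure_tensor M boole x (VBool True)))"
  unfolding finite_semimodules_simps
proof (rule inverse_arrowsI)
  let ?g = "\<lambda>x\<in>carrier M. pure_tensor M boole x (VBool True)"
  show g: "?g \<in> semimod_hom M (tensor M boole)"
    using M by (intro pure_tensor_hom_left) simp_all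
  show "compose (carrier (tensor M boole)) ?g (runit_map M) = (\<lambda>x\<in>carrier (tensor M boole). x)"
    by (rule tensor_hom_eqI[OF M fin_semimod_boole semimod_hom_compose[OF _ runit_map_hom g]])
      (use M in \<open>auto simp: fin_semimodD semimod_hom_id compose_eq runit_map_pure
        pure_tensor_False pure_tensor_zero_left split: if_splits\<close>)
  show "compose (carrier M) (runit_map M) ?g = (\<lambda>x\<in>carrier M. x)"
    using M by (auto simp: compose_def runit_map_pure)
qed (use M in \<open>simp_all add: runit_map_hom\<close>)

text \<open>These rules show that both sides of a coherence law are homomorphisms;
  \<open>structure_pures\<close> then evaluates the two sides on pure tensors.\<close>

lemmas structure_homs = semimod_hom_compose tensor_map_hom swap_map_hom assoc_map_hom
  lunit_map_hom runit_map_hom semimod_hom_id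

lemmas structure_pures = compose_eq tensor_map_pure swap_map_pure assoc_map_pure lunit_map_pure
  runit_map_pure

lemma category_finite_semimodules: "category finite_semimodules"
proof
  fix f :: "'a semimod_arrow" assume f: "f \<in> Arr finite_semimodules"
  then show "Dom finite_semimodules f \<in> Obj finite_semimodules"
    "Cod finite_semimodules f \<in> Obj finite_semimodules"
    by (cases f; simp add: finite_semimodules_simps Arr_finite_semimodules)+
next
  fix X :: "'a univ monoid" assume "X \<in> Obj finite_semimodules"
  then show "Ident finite_semimodules X \<in> Homset finite_semimodules X X"
    by (simp add: Homset_finite_semimodules finite_semimodules_simps semimod_hom_id fin_semimodD)
next
  fix f g :: "'a semimod_arrow" and X Y Z
  assume "f \<in> Homset finite_semimodules X Y" "g \<in> Homset finite_semimodules Y Z"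
  then show "g \<cdot>\<^bsub>finite_semimodules\<^esub> f \<in> Homset finite_semimodules X Z"
    by (auto simp: Homset_finite_semimodules finite_semimodules_simps fin_semimodD
        intro: semimod_hom_compose[OF fin_semimodD(3)])
next
  fix f g h :: "'a semimod_arrow" and W X Y Z
  assume "f \<in> Homset finite_semimodules W X" "g \<in> Homset finite_semimodules X Y"
    "h \<in> Homset finite_semimodules Y Z"
  then show "h \<cdot>\<^bsub>finite_semimodules\<^esub> (g \<cdot>\<^bsub>finite_semimodules\<^esub> f) =
      h \<cdot>\<^bsub>finite_semimodules\<^esub> g \<cdot>\<^bsub>finite_semimodules\<^esub> f"
    by (auto simp: Homset_finite_semimodules finite_semimodules_simps compose_def
        restrict_def semimod_homD(1))
next
  fix f :: "'a semimod_arrow" and X Y assume "f \<in> Homset finite_semimodules X Y"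
  then obtain h where h: "f = Arrow X Y h" "h \<in> semimod_hom X Y" by (rule Homset_cases)
  \<comment> \<open>The unit laws hold as equations of HOL functions because \<open>h\<close>, like
    every \<open>compose\<close>, takes the value \<open>undefined\<close> off the carrier.\<close>
  have "compose (carrier X) (\<lambda>x\<in>carrier Y. x) h = h"
    by (rule extensionalityI[of _ "carrier X"])
      (simp_all add: semimod_homD[OF h(2)] compose_eq)
  moreover have "compose (carrier X) h (\<lambda>x\<in>carrier X. x) = h"
    by (rule extensionalityI[of _ "carrier X"])
      (simp_all add: semimod_homD[OF h(2)] compose_eq)
  ultimately show "Ident finite_semimodules Y \<cdot>\<^bsub>finite_semimodules\<^esub> f = f"
    "f \<cdot>\<^bsub>finite_semimodules\<^esub> Ident finite_semimodules X = f"
    by (simp_all add: h finite_semimodules_simps)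
qed

theorem symmetric_monoidal_category_finite_semimodules:
  "symmetric_monoidal_category (finite_semimodules :: ('a univ monoid, 'a semimod_arrow) sym_monoidal)"
    (is "symmetric_monoidal_category ?C")
proof (rule symmetric_monoidal_category.intro[OF category_finite_semimodules], unfold_locales)
  show "Unit ?C \<in> Obj ?C" by (simp add: finite_semimodules_simps)
next
  fix X Y assume "X \<in> Obj ?C" "Y \<in> Obj ?C"
  then show "X \<odot>\<^bsub>?C\<^esub> Y \<in> Obj ?C" by (simp add: finite_semimodules_simps)
next
  fix f g X X' Y Y' assume "f \<in> Homset ?C X X'" "g \<in> Homset ?C Y Y'"
  then show "f \<boxtimes>\<^bsub>?C\<^esub> g \<in> Homset ?C (X \<odot>\<^bsub>?C\<^esub> Y) (X' \<odot>\<^bsub>?C\<^esub> Y')"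
    by (auto simp: finite_semimodules_simps Homset_finite_semimodules intro: tensor_map_hom)
next
  fix X Y assume "X \<in> Obj ?C" "Y \<in> Obj ?C"
  then have XY: "fin_semimod X" "fin_semimod Y" by (simp_all add: finite_semimodules_simps)
  have "tensor_map X Y X Y (\<lambda>x\<in>carrier X. x) (\<lambda>x\<in>carrier Y. x) =
      (\<lambda>x\<in>carrier (tensor X Y). x)"
    by (rule tensor_hom_eqI[OF XY]; (rule structure_homs)?)
      (simp_all add: XY fin_semimodD semimod_hom_id structure_pures)
  then show "Ident ?C X \<boxtimes>\<^bsub>?C\<^esub> Ident ?C Y = Ident ?C (X \<odot>\<^bsub>?C\<^esub> Y)"
    by (simp add: finite_semimodules_simps)
next
  fix f f' g g' X X' X'' Y Y' Y''
  assume "f \<in> Homset ?C X X'" "f' \<in> Homset ?C X' X''" "g \<in> Homset ?C Y Y'" "g' \<in> Homset ?C Y' Y''"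
  then obtain h h' k k' where
    a: "f = Arrow X X' h" "f' = Arrow X' X'' h'" "g = Arrow Y Y' k" "g' = Arrow Y' Y'' k'" and
    fin: "fin_semimod X" "fin_semimod X'" "fin_semimod X''"
      "fin_semimod Y" "fin_semimod Y'" "fin_semimod Y''" and
    homs: "h \<in> semimod_hom X X'" "h' \<in> semimod_hom X' X''"
      "k \<in> semimod_hom Y Y'" "k' \<in> semimod_hom Y' Y''"
    by (auto simp: Homset_finite_semimodules)
  have c: "compose (carrier X) h' h \<in> semimod_hom X X''"
    "compose (carrier Y) k' k \<in> semimod_hom Y Y''"
    using fin homs by (auto intro: semimod_hom_compose fin_semimodD)
  have "tensor_map X Y X'' Y'' (compose (carrier X) h' h) (compose (carrier Y) k' k) =
      compose (carrier (tensor X Y)) (tensor_map X' Y' X'' Y'' h' k') (tensor_map X Y X' Y' h k)"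
    by (rule tensor_hom_eqI[of X Y], (rule structure_homs c homs | simp add: fin fin_semimodD)+)
      (simp_all add: fin homs c fin_semimodD structure_pures homs[THEN semimod_homD(1)])
  then show "(f' \<cdot>\<^bsub>?C\<^esub> f) \<boxtimes>\<^bsub>?C\<^esub> (g' \<cdot>\<^bsub>?C\<^esub> g) = (f' \<boxtimes>\<^bsub>?C\<^esub> g') \<cdot>\<^bsub>?C\<^esub> (f \<boxtimes>\<^bsub>?C\<^esub> g)"
    by (simp add: a finite_semimodules_simps)
next
  fix X Y Z assume "X \<in> Obj ?C" "Y \<in> Obj ?C" "Z \<in> Obj ?C"
  then have fin: "fin_semimod X" "fin_semimod Y" "fin_semimod Z"
    by (simp_all add: finite_semimodules_simps)
  show "Associator ?C X Y Z \<in> Homset ?C (X \<odot>\<^bsub>?C\<^esub> Y \<odot>\<^bsub>?C\<^esub> Z) (X \<odot>\<^bsub>?C\<^esub> (Y \<odot>\<^bsub>?C\<^esub> Z))"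
    by (simp add: fin finite_semimodules_simps Homset_finite_semimodules assoc_map_hom)
  show "is_isomorphism ?C (Associator ?C X Y Z)"
    unfolding is_isomorphism_def using inverse_arrows_assoc[OF fin] by blast
next
  fix f g h X X' Y Y' Z Z'
  assume "f \<in> Homset ?C X X'" "g \<in> Homset ?C Y Y'" "h \<in> Homset ?C Z Z'"
  then obtain p q r where a: "f = Arrow X X' p" "g = Arrow Y Y' q" "h = Arrow Z Z' r" and
    fin: "fin_semimod X" "fin_semimod X'" "fin_semimod Y" "fin_semimod Y'"
      "fin_semimod Z" "fin_semimod Z'" and
    homs: "p \<in> semimod_hom X X'" "q \<in> semimod_hom Y Y'" "r \<in> semimod_hom Z Z'"
    by (auto simp: Homset_finite_semimodules)
  have "compose (carrier (tensor (tensor X Y) Z)) (assoc_map X' Y' Z')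
        (tensor_map (tensor X Y) Z (tensor X' Y') Z' (tensor_map X Y X' Y' p q) r) =
      compose (carrier (tensor (tensor X Y) Z))
        (tensor_map X (tensor Y Z) X' (tensor Y' Z') p (tensor_map Y Z Y' Z' q r))
        (assoc_map X Y Z)"
    by (rule tensor_hom_eqI3[of X Y Z], (rule structure_homs homs | simp add: fin fin_semimodD)+)
      (simp_all add: fin homs fin_semimodD structure_pures tensor_map_hom homs[THEN semimod_homD(1)])
  then show "Associator ?C X' Y' Z' \<cdot>\<^bsub>?C\<^esub> (f \<boxtimes>\<^bsub>?C\<^esub> g \<boxtimes>\<^bsub>?C\<^esub> h) =
      (f \<boxtimes>\<^bsub>?C\<^esub> (g \<boxtimes>\<^bsub>?C\<^esub> h)) \<cdot>\<^bsub>?C\<^esub> Associator ?C X Y Z"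
    by (simp add: a finite_semimodules_simps)
next
  fix X assume "X \<in> Obj ?C"
  then have fin: "fin_semimod X" by (simp_all add: finite_semimodules_simps)
  show "LUnitor ?C X \<in> Homset ?C (Unit ?C \<odot>\<^bsub>?C\<^esub> X) X"
    "RUnitor ?C X \<in> Homset ?C (X \<odot>\<^bsub>?C\<^esub> Unit ?C) X"
    by (simp_all add: fin finite_semimodules_simps Homset_finite_semimodules lunit_map_hom runit_map_hom)
  show "is_isomorphism ?C (LUnitor ?C X)" "is_isomorphism ?C (RUnitor ?C X)"
    unfolding is_isomorphism_def
    using inverse_arrows_lunit[OF fin] inverse_arrows_runit[OF fin] by blast+
next
  fix f X Y assume "f \<in> Homset ?C X Y"
  then obtain p where a: "f = Arrow X Y p" and fin: "fin_semimod X" "fin_semimod Y" and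
    homs: "p \<in> semimod_hom X Y"
    by (rule Homset_cases)
  \<comment> \<open>At b and x the law reads p(bx) = b p(x), which for b = 0 is p(0) = 0.\<close>
  have "compose (carrier (tensor boole X)) (lunit_map Y)
        (tensor_map boole X boole Y (\<lambda>x\<in>carrier boole. x) p) =
      compose (carrier (tensor boole X)) p (lunit_map X)"
    by (rule tensor_hom_eqI[of boole X], (rule structure_homs homs | simp add: fin fin_semimodD)+)
      (use fin in \<open>auto simp: homs fin_semimodD structure_pures semimod_hom_id[of boole, simplified]
        semimod_homD[OF homs]\<close>)
  then show "LUnitor ?C Y \<cdot>\<^bsub>?C\<^esub> (Ident ?C (Unit ?C) \<boxtimes>\<^bsub>?C\<^esub> f) = f \<cdot>\<^bsub>?C\<^esub> LUnitor ?C X"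
    by (simp add: a finite_semimodules_simps)
  have "compose (carrier (tensor X boole)) (runit_map Y)
        (tensor_map X boole Y boole p (\<lambda>x\<in>carrier boole. x)) =
      compose (carrier (tensor X boole)) p (runit_map X)"
    by (rule tensor_hom_eqI[of X boole], (rule structure_homs homs | simp add: fin fin_semimodD)+)
      (use fin in \<open>auto simp: homs fin_semimodD structure_pures semimod_hom_id[of boole, simplified]
        semimod_homD[OF homs]\<close>)
  then show "RUnitor ?C Y \<cdot>\<^bsub>?C\<^esub> (f \<boxtimes>\<^bsub>?C\<^esub> Ident ?C (Unit ?C)) = f \<cdot>\<^bsub>?C\<^esub> RUnitor ?C X"
    by (simp add: a finite_semimodules_simps)
next
  fix W X Y Z assume "W \<in> Obj ?C" "X \<in> Obj ?C" "Y \<in> Obj ?C" "Z \<in> Obj ?C"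
  then have fin: "fin_semimod W" "fin_semimod X" "fin_semimod Y" "fin_semimod Z"
    by (simp_all add: finite_semimodules_simps)
  \<comment> \<open>Both paths rebracket ((w x) y) z as w (x (y z)).\<close>
  have "compose (carrier (tensor (tensor (tensor W X) Y) Z))
        (assoc_map W X (tensor Y Z)) (assoc_map (tensor W X) Y Z) =
      compose (carrier (tensor (tensor (tensor W X) Y) Z))
        (compose (carrier (tensor (tensor W (tensor X Y)) Z))
          (tensor_map W (tensor (tensor X Y) Z) W (tensor X (tensor Y Z))
            (\<lambda>x\<in>carrier W. x) (assoc_map X Y Z))
          (assoc_map W (tensor X Y) Z))
        (tensor_map (tensor (tensor W X) Y) Z (tensor W (tensor X Y)) Z
          (assoc_map W X Y) (\<lambda>x\<in>carrier Z. x))"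
    by (rule tensor_hom_eqI4[of W X Y Z], (rule structure_homs | simp add: fin fin_semimodD)+)
      (simp_all add: fin fin_semimodD structure_pures semimod_hom_id assoc_map_hom)
  then show "Associator ?C W X (Y \<odot>\<^bsub>?C\<^esub> Z) \<cdot>\<^bsub>?C\<^esub> Associator ?C (W \<odot>\<^bsub>?C\<^esub> X) Y Z =
      (Ident ?C W \<boxtimes>\<^bsub>?C\<^esub> Associator ?C X Y Z) \<cdot>\<^bsub>?C\<^esub> Associator ?C W (X \<odot>\<^bsub>?C\<^esub> Y) Z
        \<cdot>\<^bsub>?C\<^esub> (Associator ?C W X Y \<boxtimes>\<^bsub>?C\<^esub> Ident ?C Z)"
    by (simp add: finite_semimodules_simps)
next
  fix X Y assume "X \<in> Obj ?C" "Y \<in> Obj ?C"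
  then have fin: "fin_semimod X" "fin_semimod Y" by (simp_all add: finite_semimodules_simps)
  \<comment> \<open>At x, b, y the law moves the scalar b from the right factor y to the left factor
    x; for b = 0 both sides are zero.\<close>
  have "compose (carrier (tensor (tensor X boole) Y))
        (tensor_map X (tensor boole Y) X Y (\<lambda>x\<in>carrier X. x) (lunit_map Y)) (assoc_map X boole Y) =
      tensor_map (tensor X boole) Y X Y (runit_map X) (\<lambda>x\<in>carrier Y. x)"
    by (rule tensor_hom_eqI3[of X boole Y], (rule structure_homs | simp add: fin fin_semimodD)+)
      (use fin in \<open>auto simp: fin_semimodD structure_pures semimod_hom_id lunit_map_hom runit_map_hom
        pure_tensor_bilinear\<close>)
  then show "(Ident ?C X \<boxtimes>\<^bsub>?C\<^esub> LUnitor ?C Y) \<cdot>\<^bsub>?C\<^esub> Associator ?C X (Unit ?C) Y =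
      RUnitor ?C X \<boxtimes>\<^bsub>?C\<^esub> Ident ?C Y"
    by (simp add: finite_semimodules_simps)
  show "Braiding ?C X Y \<in> Homset ?C (X \<odot>\<^bsub>?C\<^esub> Y) (Y \<odot>\<^bsub>?C\<^esub> X)"
    by (simp add: fin finite_semimodules_simps Homset_finite_semimodules swap_map_hom)
  have "compose (carrier (tensor X Y)) (swap_map Y X) (swap_map X Y) =
      (\<lambda>x\<in>carrier (tensor X Y). x)"
    by (rule tensor_hom_eqI[of X Y], (rule structure_homs | simp add: fin fin_semimodD)+)
      (simp_all add: fin structure_pures)
  then show "Braiding ?C Y X \<cdot>\<^bsub>?C\<^esub> Braiding ?C X Y = Ident ?C (X \<odot>\<^bsub>?C\<^esub> Y)"
    by (simp add: finite_semimodules_simps)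
next
  fix f g X X' Y Y' assume "f \<in> Homset ?C X X'" "g \<in> Homset ?C Y Y'"
  then obtain p q where a: "f = Arrow X X' p" "g = Arrow Y Y' q" and
    fin: "fin_semimod X" "fin_semimod X'" "fin_semimod Y" "fin_semimod Y'" and
    homs: "p \<in> semimod_hom X X'" "q \<in> semimod_hom Y Y'"
    by (auto simp: Homset_finite_semimodules)
  have "compose (carrier (tensor X Y)) (swap_map X' Y') (tensor_map X Y X' Y' p q) =
      compose (carrier (tensor X Y)) (tensor_map Y X Y' X' q p) (swap_map X Y)"
    by (rule tensor_hom_eqI[of X Y], (rule structure_homs homs | simp add: fin fin_semimodD)+)
      (simp_all add: fin homs structure_pures homs[THEN semimod_homD(1)])
  then show "Braiding ?C X' Y' \<cdot>\<^bsub>?C\<^esub> (f \<boxtimes>\<^bsub>?C\<^esub> g) = (g \<boxtimes>\<^bsub>?C\<^esub> f) \<cdot>\<^bsub>?C\<^esub> Braiding ?C X Y"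
    by (simp add: a finite_semimodules_simps)
next
  fix X Y Z assume "X \<in> Obj ?C" "Y \<in> Obj ?C" "Z \<in> Obj ?C"
  then have fin: "fin_semimod X" "fin_semimod Y" "fin_semimod Z"
    by (simp_all add: finite_semimodules_simps)
  \<comment> \<open>Both paths carry (x y) z to y (z x).\<close>
  have "compose (carrier (tensor (tensor X Y) Z))
        (compose (carrier (tensor X (tensor Y Z))) (assoc_map Y Z X) (swap_map X (tensor Y Z)))
        (assoc_map X Y Z) =
      compose (carrier (tensor (tensor X Y) Z))
        (compose (carrier (tensor (tensor Y X) Z))
          (tensor_map Y (tensor X Z) Y (tensor Z X) (\<lambda>x\<in>carrier Y. x) (swap_map X Z))
          (assoc_map Y X Z))
        (tensor_map (tensor X Y) Z (tensor Y X) Z (swap_map X Y) (\<lambda>x\<in>carrier Z. x))"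
    by (rule tensor_hom_eqI3[of X Y Z], (rule structure_homs | simp add: fin fin_semimodD)+)
      (simp_all add: fin fin_semimodD structure_pures semimod_hom_id swap_map_hom)
  then show "Associator ?C Y Z X \<cdot>\<^bsub>?C\<^esub> Braiding ?C X (Y \<odot>\<^bsub>?C\<^esub> Z) \<cdot>\<^bsub>?C\<^esub> Associator ?C X Y Z =
      (Ident ?C Y \<boxtimes>\<^bsub>?C\<^esub> Braiding ?C X Z) \<cdot>\<^bsub>?C\<^esub> Associator ?C Y X Z
        \<cdot>\<^bsub>?C\<^esub> (Braiding ?C X Y \<boxtimes>\<^bsub>?C\<^esub> Ident ?C Z)"
    by (simp add: finite_semimodules_simps)
qed

section \<open>Full monoidal subcategories\<close>

lemma full_subcategory_simps [simp]:
  fixes C :: "('o, 'm, 'z) sym_monoidal_scheme"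
  shows "Obj (full_subcategory C S) = Obj C \<inter> S"
    "Dom (full_subcategory C S) = Dom C"
    "Cod (full_subcategory C S) = Cod C"
    "Ident (full_subcategory C S) = Ident C"
    "Comp (full_subcategory C S) = Comp C"
    "Unit (full_subcategory C S) = Unit C"
    "TenO (full_subcategory C S) = TenO C"
    "TenA (full_subcategory C S) = TenA C"
    "Associator (full_subcategory C S) = Associator C"
    "LUnitor (full_subcategory C S) = LUnitor C"
    "RUnitor (full_subcategory C S) = RUnitor C"
    "Braiding (full_subcategory C S) = Braiding C"
  by (simp_all add: full_subcategory_def)

lemma Arr_full_subcategory:
  "f \<in> Arr (full_subcategory C S) \<longleftrightarrow> f \<in> Arr C \<and> Dom C f \<in> S \<and> Cod C f \<in> S"
  by (simp add: full_subcategory_def)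

lemma Homset_full_subcategory:
  fixes C :: "('o, 'm, 'z) sym_monoidal_scheme"
  shows "f \<in> Homset (full_subcategory C S) X Y \<longleftrightarrow> f \<in> Homset C X Y \<and> X \<in> S \<and> Y \<in> S"
  by (auto simp: Homset_def Arr_full_subcategory)

text \<open>An inverse of \<open>f\<close> runs between the same two objects, so fullness places it
  in the subcategory.\<close>

lemma inverse_arrows_full_subcategory:
  fixes C :: "('o, 'm, 'z) sym_monoidal_scheme"
  assumes "f \<in> Homset C X Y" "X \<in> S" "Y \<in> S"
  shows "inverse_arrows (full_subcategory C S) f g \<longleftrightarrow> inverse_arrows C f g"
  using assms unfolding inverse_arrows_def Homset_full_subcategory
  by (auto simp: Homset_def Arr_full_subcategory)

lemma is_isomorphism_full_subcategory:
  fixes C :: "('o, 'm, 'z) sym_monoidal_scheme"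
  assumes "f \<in> Homset C X Y" "X \<in> S" "Y \<in> S"
  shows "is_isomorphism (full_subcategory C S) f \<longleftrightarrow> is_isomorphism C f"
  by (simp add: is_isomorphism_def inverse_arrows_full_subcategory[OF assms])

lemma inv_arrow_full_subcategory:
  fixes C :: "('o, 'm, 'z) sym_monoidal_scheme"
  assumes "f \<in> Homset C X Y" "X \<in> S" "Y \<in> S"
  shows "inv_arrow (full_subcategory C S) f = inv_arrow C f"
  by (simp add: inv_arrow_def inverse_arrows_full_subcategory[OF assms])

text \<open>Two-sided inverses are unique, so the description \<open>inv_arrow\<close> evaluates to
  whichever inverse has been exhibited. This is how the explicit inverses enter the zigzag
  identities.\<close>

lemma (in category) inv_arrow_eqI:
  assumes "inverse_arrows C f g"
  shows "inv_arrow C f = g"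
  unfolding inv_arrow_def
proof (rule the_equality[where P = "inverse_arrows C f", OF assms])
  fix h assume h: "inverse_arrows C f h"
  let ?X = "Dom C f" and ?Y = "Cod C f"
  have f: "f \<in> Homset C ?X ?Y" using assms by (simp add: inverse_arrows_def Homset_def)
  have g: "g \<in> Homset C ?Y ?X" "g \<cdot> f = Ident C ?X" using assms by (simp_all add: inverse_arrows_def)
  have h': "h \<in> Homset C ?Y ?X" "f \<cdot> h = Ident C ?Y" using h by (simp_all add: inverse_arrows_def)
  have "h = g \<cdot> f \<cdot> h" using ident_left[OF h'(1)] g(2) by simp
  also have "\<dots> = g" using comp_assoc[OF h'(1) f g(1)] h'(2) ident_right[OF g(1)] by simp
  finally show "h = g" .
qed

context symmetric_monoidal_category
begin

text \<open>The laws are equations between ambient morphisms and carry over, since closure of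
  \<open>S\<close> places the structure maps in the subcategory. Only invertibility asks for a
  morphism outside the given structure, hence \<open>iso_assoc\<close> and
  \<open>iso_unit\<close>.\<close>

lemma full_monoidal_subcategory:
  assumes unit: "Unit C \<in> S"
    and ten: "\<And>X Y. \<lbrakk>X \<in> Obj C; Y \<in> Obj C; X \<in> S; Y \<in> S\<rbrakk> \<Longrightarrow> X \<odot> Y \<in> S"
  shows "symmetric_monoidal_category (full_subcategory C S)"
proof -
  let ?D = "full_subcategory C S"
  have hom_obj: "X \<in> Obj C" "Y \<in> Obj C" if "f \<in> Homset C X Y" for f X Y
    using that dom_obj cod_obj by (auto simp: Homset_def)
  have iso: "is_isomorphism ?D f" if "is_isomorphism C f" "f \<in> Homset C X Y" "X \<in> S" "Y \<in> S"
    for f X Y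
    using is_isomorphism_full_subcategory that by metis
  have iso_assoc: "is_isomorphism ?D (Associator C X Y Z)"
    if "X \<in> Obj C" "Y \<in> Obj C" "Z \<in> Obj C" "X \<in> S" "Y \<in> S" "Z \<in> S" for X Y Z
    by (rule iso[OF assoc_iso assoc_hom]) (use that tensor_obj ten in auto)
  have iso_unit: "is_isomorphism ?D (LUnitor C X)" "is_isomorphism ?D (RUnitor C X)"
    if "X \<in> Obj C" "X \<in> S" for X
    by (rule iso[OF lunit_iso lunit_hom] iso[OF runit_iso runit_hom];
        use that unit unit_obj tensor_obj ten in auto)+
  show ?thesis
    by unfold_locales
      (auto simp: Homset_full_subcategory Arr_full_subcategory unit ten iso_assoc iso_unit
        unit_obj tensor_obj tensor_ident hom_obj
        intro: dom_obj cod_obj ident_hom comp_hom comp_assoc ident_left ident_right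
          tensor_hom tensor_comp assoc_hom assoc_natural lunit_hom lunit_natural runit_hom
          runit_natural pentagon triangle braid_hom braid_natural braid_symmetric hexagon)
qed

text \<open>The zigzag equations are the ambient ones as soon as inverses taken in the subcategory
  are identified with ambient inverses.\<close>

lemma is_dual_full_subcategory:
  assumes "is_dual C X X' ev coev" "X \<in> S" "X' \<in> S" "Unit C \<in> S"
    and ten: "\<And>X Y. \<lbrakk>X \<in> Obj C; Y \<in> Obj C; X \<in> S; Y \<in> S\<rbrakk> \<Longrightarrow> X \<odot> Y \<in> S"
  shows "is_dual (full_subcategory C S) X X' ev coev"
proof -
  have X: "X \<in> Obj C" "X' \<in> Obj C" using assms(1) by (simp_all add: is_dual_def)
  have inv: "inv_arrow (full_subcategory C S) (LUnitor C X) = inv_arrow C (LUnitor C X)"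
    "inv_arrow (full_subcategory C S) (RUnitor C X') = inv_arrow C (RUnitor C X')"
    "inv_arrow (full_subcategory C S) (Associator C X' X X') = inv_arrow C (Associator C X' X X')"
    using X assms unit_obj
    by (auto intro!: inv_arrow_full_subcategory lunit_hom runit_hom assoc_hom ten tensor_obj)
  show ?thesis
    using assms(1-4) X unit_obj unfolding is_dual_def
    by (simp add: Homset_full_subcategory inv ten)
qed

end

section \<open>Projective semimodules\<close>

text \<open>For finite \<open>A\<close> this is the free semimodule on \<open>A\<close>: a subset is
  a formal sum with coefficients 0 and 1.\<close>

definition powerset_semimodule :: "'b set \<Rightarrow> 'b set monoid" where
  "powerset_semimodule A = \<lparr>carrier = Pow A, mult = (\<union>), one = {}\<rparr>"

lemma powerset_semimodule_simps [simp]: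
  "carrier (powerset_semimodule A) = Pow A"
  "B \<otimes>\<^bsub>powerset_semimodule A\<^esub> C = B \<union> C"
  "\<one>\<^bsub>powerset_semimodule A\<^esub> = {}"
  by (simp_all add: powerset_semimodule_def)

lemma boolean_semimodule_powerset: "boolean_semimodule (powerset_semimodule A)"
  by unfold_locales auto

text \<open>The extension of \<open>e\<close> from generators to the free semimodule. Overlaps of
  two subsets do no harm, because repeated summands are absorbed by idempotence in
  \<open>finprod_Un\<close>.\<close>

lemma finprod_powerset_hom:
  assumes "boolean_semimodule P" "finite A" "e \<in> A \<rightarrow> carrier P"
  shows "(\<lambda>B\<in>Pow A. finprod P e B) \<in> semimod_hom (powerset_semimodule A) P"
proof -
  interpret boolean_semimodule P by fact
  have sub: "e \<in> B \<rightarrow> carrier P" "finite B" if "B \<subseteq> A" for B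
    using that assms finite_subset by auto
  show ?thesis by (rule semimod_homI) (simp_all add: sub finprod_closed finprod_Un)
qed

text \<open>
  The map \<open>s\<close> splits the surjection \<open>finprod P e\<close> from the free semimodule on \<open>A\<close>; the functionals
  of the dual basis are \<open>x \<mapsto> (a \<in> s x)\<close>.
\<close>

definition dual_basis :: "'a monoid \<Rightarrow> 'b set \<Rightarrow> ('b \<Rightarrow> 'a) \<Rightarrow> ('a \<Rightarrow> 'b set) \<Rightarrow> bool" where
  "dual_basis P A e s \<longleftrightarrow> finite A \<and> e \<in> A \<rightarrow> carrier P \<and>
     s \<in> semimod_hom P (powerset_semimodule A) \<and> (\<forall>x\<in>carrier P. finprod P e (s x) = x)"

lemma dual_basisD:
  assumes "dual_basis P A e s"
  shows "finite A" "a \<in> A \<Longrightarrow> e a \<in> carrier P"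
    and "x \<in> carrier P \<Longrightarrow> s x \<subseteq> A"
    and "\<lbrakk>x \<in> carrier P; y \<in> carrier P\<rbrakk> \<Longrightarrow> s (x \<otimes>\<^bsub>P\<^esub> y) = s x \<union> s y"
    and "s \<one>\<^bsub>P\<^esub> = {}"
    and "x \<in> carrier P \<Longrightarrow> finprod P e (s x) = x"
    and "s \<in> semimod_hom P (powerset_semimodule A)"
  using assms semimod_homD[of s P "powerset_semimodule A"] by (auto simp: dual_basis_def)

text \<open>All elements of \<open>P\<close> serve as generators, so singletons make the summation
  map onto, and \<open>s\<close> is a lift of the identity along it.\<close>

lemma projective_imp_dual_basis:
  assumes "projective P" "finite (carrier P)"
  shows "\<exists>s. dual_basis P (carrier P) (\<lambda>x. x) s"
proof -
  interpret P: boolean_semimodule P using assms by (simp add: projective_def)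
  let ?g = "\<lambda>B\<in>Pow (carrier P). finprod P (\<lambda>x. x) B"
  have g: "?g \<in> semimod_hom (powerset_semimodule (carrier P)) P"
    using assms by (intro finprod_powerset_hom P.boolean_semimodule_axioms) auto
  have "x \<in> ?g ` Pow (carrier P)" if "x \<in> carrier P" for x
    using that by (intro image_eqI[of _ _ "{x}"]) auto
  then have "?g ` Pow (carrier P) = carrier P" using semimod_homD(1)[OF g] by auto
  \<comment> \<open>The source of \<open>?g\<close> lies over a type of sets, so the lifting
    property is needed beyond the universe.\<close>
  then obtain s where s: "s \<in> semimod_hom P (powerset_semimodule (carrier P))"
    "compose (carrier P) ?g s = (\<lambda>x\<in>carrier P. x)"
    using projective_lifts[OF assms boolean_semimodule_powerset P.boolean_semimodule_axioms g _
        semimod_hom_id[OF P.monoid_axioms]] by auto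
  have "finprod P (\<lambda>x. x) (s x) = x" if "x \<in> carrier P" for x
    using fun_cong[OF s(2), of x] semimod_homD(1)[OF s(1) that] that by (simp add: compose_eq)
  then show ?thesis using s(1) assms(2) by (auto simp: dual_basis_def)
qed

text \<open>\<open>P\<close> is a retract of a free semimodule, and maps out of a free semimodule
  lift by choosing preimages \<open>u a\<close> of the values \<open>h (e a)\<close>. Precomposition
  with \<open>s\<close> gives the lift on \<open>P\<close>.\<close>

lemma dual_basis_imp_projective:
  assumes P: "boolean_semimodule P" and b: "dual_basis P A e s"
  shows "projective P"
  unfolding projective_def
proof (intro conjI P allI impI ballI)
  fix M N :: "'a univ monoid" and g h
  assume g: "boolean_semimodule M \<and> boolean_semimodule N \<and> g \<in> semimod_hom M N \<and>
      g ` carrier M = carrier N" and h: "h \<in> semimod_hom P N"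
  interpret P: boolean_semimodule P by fact
  interpret M: boolean_semimodule M using g by blast
  interpret N: boolean_semimodule N using g by blast
  note b = dual_basisD[OF b]
  have "\<forall>a\<in>A. \<exists>v\<in>carrier M. g v = h (e a)"
    using g b(2) semimod_homD(1)[OF h] by (metis imageE)
  then obtain u where u: "\<And>a. a \<in> A \<Longrightarrow> u a \<in> carrier M" "\<And>a. a \<in> A \<Longrightarrow> g (u a) = h (e a)"
    by metis
  let ?k = "compose (carrier P) (\<lambda>B\<in>Pow A. finprod M u B) s"
  have "?k \<in> semimod_hom P M"
    using u b(1)
    by (intro semimod_hom_compose[OF P.monoid_axioms b(7)] finprod_powerset_hom
        M.boolean_semimodule_axioms) auto
  moreover have "compose (carrier P) g ?k = h"
  proof (rule extensionalityI[of _ "carrier P"])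
    fix x assume x: "x \<in> carrier P"
    note sx = finite_subset[OF b(3)[OF x] b(1)] b(3)[OF x]
    have "g (finprod M u (s x)) = finprod N (\<lambda>a. g (u a)) (s x)"
      using sx u g by (intro semimod_hom_finprod M.boolean_semimodule_axioms N.boolean_semimodule_axioms) auto
    also have "\<dots> = finprod N (\<lambda>a. h (e a)) (s x)"
      using sx u b(2) semimod_homD(1)[OF h] by (intro N.finprod_cong') auto
    also have "\<dots> = h (finprod P e (s x))"
      using sx b(2)
      by (intro semimod_hom_finprod[symmetric] P h N.boolean_semimodule_axioms) auto
    finally show "compose (carrier P) g ?k x = h x" using x b(3,6) by (simp add: compose_eq)
  qed (use semimod_homD(4)[OF h] in auto)
  ultimately show "\<exists>k\<in>semimod_hom P M. compose (carrier P) g k = h" by blast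
qed

section \<open>Projectivity of the unit and of tensor products\<close>

lemma projective_boole: "projective (boole :: 'a univ monoid)"
proof (rule dual_basis_imp_projective[OF fin_semimodD(1)[OF fin_semimod_boole]])
  interpret boolean_semimodule "boole :: 'a univ monoid"
    by (rule fin_semimodD(1)[OF fin_semimod_boole])
  \<comment> \<open>The unit is free on one generator, indexed by \<open>()\<close>.\<close>
  show "dual_basis boole {()} (\<lambda>_. VBool True :: 'a univ)
      (\<lambda>b\<in>carrier boole. if b = VBool True then {()} else {})"
    unfolding dual_basis_def
  proof (intro conjI semimod_homI ballI)
    fix x :: "'a univ" assume "x \<in> carrier boole"
    then show "finprod boole (\<lambda>_. VBool True)
        ((\<lambda>b\<in>carrier boole. if b = VBool True then {()} else {}) x) = x"
      by (auto simp: finprod_insert)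
  qed auto
qed

text \<open>Distributivity, one factor at a time: \<open>row\<close> sums over \<open>B\<close> by
  linearity in the right factor, and the induction on \<open>A\<close> sums the rows by linearity in
  the left one.\<close>

lemma finprod_pure_tensor:
  assumes fin: "fin_semimod M" "fin_semimod N" and AB: "finite A" "finite B"
    and f: "f \<in> A \<rightarrow> carrier M" and g: "g \<in> B \<rightarrow> carrier N"
  shows "finprod (tensor M N) (\<lambda>(a, b). pure_tensor M N (f a) (g b)) (A \<times> B) =
    pure_tensor M N (finprod M f A) (finprod N g B)"
proof -
  interpret M: boolean_semimodule M by (rule fin_semimodD[OF fin(1)])
  interpret N: boolean_semimodule N by (rule fin_semimodD[OF fin(2)])
  interpret T: boolean_semimodule "tensor M N" by (rule fin_semimodD(1)[OF fin_semimod_tensor[OF fin]])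
  let ?h = "\<lambda>(a, b). pure_tensor M N (f a) (g b)"
  have gB: "finprod N g B \<in> carrier N" using g by (rule N.finprod_closed)
  have row: "finprod (tensor M N) ?h ({a} \<times> B) = pure_tensor M N (f a) (finprod N g B)"
    if a: "f a \<in> carrier M" for a
  proof -
    have inj: "inj_on (Pair a) B" by (simp add: inj_on_def)
    have im: "{a} \<times> B = Pair a ` B" by auto
    have "finprod (tensor M N) ?h ({a} \<times> B) = finprod (tensor M N) (\<lambda>b. ?h (a, b)) B"
      unfolding im using fin a g by (intro T.finprod_reindex inj) (auto simp: Pi_iff)
    also have "\<dots> = finprod (tensor M N) (\<lambda>b. (\<lambda>y\<in>carrier N. pure_tensor M N (f a) y) (g b)) B"
      using fin a g by (intro T.finprod_cong') (auto simp: Pi_iff)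
    also have "\<dots> = (\<lambda>y\<in>carrier N. pure_tensor M N (f a) y) (finprod N g B)"
      using AB(2) g
      by (intro semimod_hom_finprod[symmetric] pure_tensor_hom_right fin a
          N.boolean_semimodule_axioms T.boolean_semimodule_axioms)
    finally show ?thesis using gB by simp
  qed
  show ?thesis
    using AB(1) f
  proof (induction A rule: finite_induct)
    case empty
    then show ?case using fin gB by (simp add: pure_tensor_zero_left)
  next
    case (insert a A)
    then have fa: "f a \<in> carrier M" "f \<in> A \<rightarrow> carrier M" by auto
    have "insert a A \<times> B = {a} \<times> B \<union> A \<times> B" by auto
    then have "finprod (tensor M N) ?h (insert a A \<times> B) =
        finprod (tensor M N) ?h ({a} \<times> B) \<otimes>\<^bsub>tensor M N\<^esub> finprod (tensor M N) ?h (A \<times> B)"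
      using insert.hyps AB(2) fin fa g by (simp only:) (rule T.finprod_Un; auto simp: Pi_iff)
    also have "\<dots> = pure_tensor M N (f a \<otimes>\<^bsub>M\<^esub> finprod M f A) (finprod N g B)"
      using insert.IH fa fin gB row by (simp add: pure_tensor_add_left M.finprod_closed)
    finally show ?case using insert.hyps fa by simp
  qed
qed

text \<open>The coefficient of a pure tensor at a pair of generators is the product of the
  coefficients, so its coordinate set is the rectangle \<open>s x \<times> t y\<close>. Rectangles
  distribute over unions in each side, which makes this bilinear.\<close>

lemma projective_tensor:
  assumes fin: "fin_semimod P" "fin_semimod Q" and "projective P" "projective Q"
  shows "projective (tensor P Q)"
proof -
  obtain s t where st: "dual_basis P (carrier P) (\<lambda>x. x) s" "dual_basis Q (carrier Q) (\<lambda>x. x) t"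
    using assms projective_imp_dual_basis fin_semimodD(4) by metis
  note s = dual_basisD[OF st(1)] and t = dual_basisD[OF st(2)]
  let ?A = "carrier P \<times> carrier Q"
  let ?e = "\<lambda>(x, y). pure_tensor P Q x y"
  let ?r = "tensor_lift P Q (powerset_semimodule ?A) (\<lambda>x y. s x \<times> t y)"
  interpret T: boolean_semimodule "tensor P Q" by (rule fin_semimodD(1)[OF fin_semimod_tensor[OF fin]])
  have b: "bilinear P Q (powerset_semimodule ?A) (\<lambda>x y. s x \<times> t y)"
    using fin s(3)[THEN subsetD] t(3)[THEN subsetD]
    by (intro bilinearI) (auto simp: fin_semimodD s(4,5) t(4,5))
  note r = tensor_lift_hom'[OF fin boolean_semimodule_powerset b]
    and r_pure = tensor_lift_pure'[OF fin boolean_semimodule_powerset b]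
  have e: "?e \<in> ?A \<rightarrow> carrier (tensor P Q)" using fin by auto
  let ?i = "compose (carrier (tensor P Q)) (\<lambda>B\<in>Pow ?A. finprod (tensor P Q) ?e B) ?r"
  \<comment> \<open>Reconstruction from coordinates is stated as an equation of homomorphisms, so
    that rectangles, the coordinate sets of pure tensors, suffice.\<close>
  have i: "?i = (\<lambda>c\<in>carrier (tensor P Q). c)"
  proof (rule tensor_hom_eqI[OF fin])
    show "?i \<in> semimod_hom (tensor P Q) (tensor P Q)"
      using s(1) t(1) e
      by (intro semimod_hom_compose[OF _ r] finprod_powerset_hom T.monoid_axioms
          T.boolean_semimodule_axioms) auto
    fix x y assume x: "x \<in> carrier P" and y: "y \<in> carrier Q"
    note sub = s(3)[OF x] finite_subset[OF s(3)[OF x] s(1)]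
      t(3)[OF y] finite_subset[OF t(3)[OF y] t(1)]
    have "finprod (tensor P Q) ?e (s x \<times> t y) =
        pure_tensor P Q (finprod P (\<lambda>x. x) (s x)) (finprod Q (\<lambda>y. y) (t y))"
      using sub by (intro finprod_pure_tensor fin) auto
    moreover have "s x \<times> t y \<subseteq> ?A" using sub by blast
    ultimately show "?i (pure_tensor P Q x y) =
        (\<lambda>c\<in>carrier (tensor P Q). c) (pure_tensor P Q x y)"
      using fin x y s(6) t(6) by (simp add: compose_eq r_pure)
  qed (rule semimod_hom_id[OF T.monoid_axioms])
  have "finprod (tensor P Q) ?e (?r c) = c" if "c \<in> carrier (tensor P Q)" for c
    using fun_cong[OF i, of c] that semimod_homD(1)[OF r that] by (simp add: compose_eq)
  then have "dual_basis (tensor P Q) ?A ?e ?r"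
    using s(1) t(1) e r by (simp add: dual_basis_def)
  then show ?thesis by (rule dual_basis_imp_projective[OF T.boolean_semimodule_axioms])
qed

section \<open>The dual of a projective semimodule\<close>

lemma semimod_hom_zero:
  "\<lbrakk>monoid P; monoid K\<rbrakk> \<Longrightarrow> (\<lambda>x\<in>carrier P. \<one>\<^bsub>K\<^esub>) \<in> semimod_hom P K"
  by (rule semimod_homI) (simp_all add: monoid.one_closed monoid.m_closed monoid.l_one)

lemma semimod_hom_add:
  assumes "monoid P" "boolean_semimodule K" "f \<in> semimod_hom P K" "g \<in> semimod_hom P K"
  shows "(\<lambda>x\<in>carrier P. f x \<otimes>\<^bsub>K\<^esub> g x) \<in> semimod_hom P K"
proof -
  interpret P: monoid P by fact
  interpret K: boolean_semimodule K by fact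
  show ?thesis
    by (rule semimod_homI)
      (simp_all add: semimod_homD[OF assms(3)] semimod_homD[OF assms(4)] K.m_ac)
qed

lemma carrier_hom_semimodule: "carrier (hom_semimodule P K) = code_fun P ` semimod_hom P K"
  by (simp add: hom_semimodule_def)

lemma decode_fun_hom:
  assumes "finite (carrier P)" "\<phi> \<in> carrier (hom_semimodule P K)"
  shows "decode_fun P K \<phi> \<in> semimod_hom P K" "code_fun P (decode_fun P K \<phi>) = \<phi>"
  using assms by (auto simp: carrier_hom_semimodule decode_code_fun)

lemma hom_semimodule_eqI:
  assumes "finite (carrier P)" "\<phi> \<in> carrier (hom_semimodule P K)" "\<psi> \<in> carrier (hom_semimodule P K)"
    "\<And>x. x \<in> carrier P \<Longrightarrow> decode_fun P K \<phi> x = decode_fun P K \<psi> x"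
  shows "\<phi> = \<psi>"
proof -
  have "decode_fun P K \<phi> = decode_fun P K \<psi>"
    using assms decode_fun_hom(1)[OF assms(1)] by (blast intro: semimod_hom_eqI)
  then show ?thesis using decode_fun_hom(2) assms by metis
qed

text \<open>Elements are compared by their values on \<open>P\<close>, which turns each semimodule
  axiom into the same axiom in \<open>K\<close>. Finiteness comes from the finite set of functions
  between the two carriers.\<close>

lemma
  assumes P: "fin_semimod P" and K: "fin_semimod K"
  shows fin_semimod_hom: "fin_semimod (hom_semimodule P K)"
    and decode_fun_one: "x \<in> carrier P \<Longrightarrow> decode_fun P K \<one>\<^bsub>hom_semimodule P K\<^esub> x = \<one>\<^bsub>K\<^esub>"
    and decode_fun_mult: "\<lbrakk>\<phi> \<in> carrier (hom_semimodule P K); \<psi> \<in> carrier (hom_semimodule P K);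
      x \<in> carrier P\<rbrakk> \<Longrightarrow> decode_fun P K (\<phi> \<otimes>\<^bsub>hom_semimodule P K\<^esub> \<psi>) x =
        decode_fun P K \<phi> x \<otimes>\<^bsub>K\<^esub> decode_fun P K \<psi> x"
proof -
  let ?H = "hom_semimodule P K" and ?d = "decode_fun P K"
  interpret K: boolean_semimodule K by (rule fin_semimodD(1)[OF K])
  note finP = fin_semimodD(4)[OF P]
  note d = decode_fun_hom[OF finP, of _ K]
  note zero = semimod_hom_zero[OF fin_semimodD(3)[OF P] K.monoid_axioms]
    and add = semimod_hom_add[OF fin_semimodD(3)[OF P] K.boolean_semimodule_axioms d(1) d(1)]
  have closed: "\<one>\<^bsub>?H\<^esub> \<in> carrier ?H"
    "\<lbrakk>\<phi> \<in> carrier ?H; \<psi> \<in> carrier ?H\<rbrakk> \<Longrightarrow> \<phi> \<otimes>\<^bsub>?H\<^esub> \<psi> \<in> carrier ?H" for \<phi> \<psi>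
    using zero add by (simp_all add: hom_semimodule_def)
  have one: "?d \<one>\<^bsub>?H\<^esub> x = \<one>\<^bsub>K\<^esub>" if "x \<in> carrier P" for x
    using that zero by (simp add: hom_semimodule_def decode_code_fun[OF finP])
  have mult: "?d (\<phi> \<otimes>\<^bsub>?H\<^esub> \<psi>) x = ?d \<phi> x \<otimes>\<^bsub>K\<^esub> ?d \<psi> x"
    if "\<phi> \<in> carrier ?H" "\<psi> \<in> carrier ?H" "x \<in> carrier P" for \<phi> \<psi> x
    using that add[OF that(1,2)] by (simp add: hom_semimodule_def decode_code_fun[OF finP])
  have val: "?d \<phi> x \<in> carrier K" if "\<phi> \<in> carrier ?H" "x \<in> carrier P" for \<phi> x
    using semimod_homD(1)[OF d(1)] that by blast
  have "semimod_hom P K \<subseteq> carrier P \<rightarrow>\<^sub>E carrier K"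
    by (auto intro: semimod_homD(1) semimod_homD(4) PiE_I simp: PiE_def)
  then have "finite (carrier ?H)"
    unfolding carrier_hom_semimodule
    using finP fin_semimodD(4)[OF K] by (meson finite_PiE finite_imageI finite_subset)
  moreover have "boolean_semimodule ?H"
    by unfold_locales
      (rule hom_semimodule_eqI[OF finP, of _ K] closed;
        simp add: closed one mult val K.m_ac K.idem)+
  ultimately show "fin_semimod ?H" by (rule fin_semimodI[rotated])
  show "x \<in> carrier P \<Longrightarrow> ?d \<one>\<^bsub>?H\<^esub> x = \<one>\<^bsub>K\<^esub>" by (rule one)
  show "\<lbrakk>\<phi> \<in> carrier ?H; \<psi> \<in> carrier ?H; x \<in> carrier P\<rbrakk>
      \<Longrightarrow> ?d (\<phi> \<otimes>\<^bsub>?H\<^esub> \<psi>) x = ?d \<phi> x \<otimes>\<^bsub>K\<^esub> ?d \<psi> x" by (rule mult)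
qed

lemma finprod_boole:
  assumes "finite A"
  shows "finprod (boole :: 'a univ monoid) (\<lambda>a. VBool (p a)) A = VBool (\<exists>a\<in>A. p a)"
proof -
  interpret boolean_semimodule "boole :: 'a univ monoid"
    by (rule fin_semimodD(1)[OF fin_semimod_boole])
  show ?thesis
    using assms by (induction A rule: finite_induct) (auto simp: finprod_insert)
qed

section \<open>Coordinates on the dual semimodule\<close>

locale projective_with_dual_basis =
  fixes P :: "'a univ monoid" and A :: "'b set" and e :: "'b \<Rightarrow> 'a univ"
    and s :: "'a univ \<Rightarrow> 'b set"
  assumes P: "fin_semimod P" and basis: "dual_basis P A e s"
begin

abbreviation D where "D \<equiv> dual_semimodule P"

abbreviation app where "app \<equiv> decode_fun P boole"

definition coord :: "'b \<Rightarrow> 'a univ" where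
  "coord a = code_fun P (\<lambda>x\<in>carrier P. VBool (a \<in> s x))"

sublocale P: boolean_semimodule P by (rule fin_semimodD(1)[OF P])

lemmas basisD = dual_basisD[OF basis]

lemma D: "fin_semimod D"
  unfolding dual_semimodule_def by (rule fin_semimod_hom[OF P fin_semimod_boole])

sublocale D: boolean_semimodule D by (rule fin_semimodD(1)[OF D])

lemma app_hom: "\<phi> \<in> carrier D \<Longrightarrow> app \<phi> \<in> semimod_hom P boole"
  unfolding dual_semimodule_def by (rule decode_fun_hom(1)[OF fin_semimodD(4)[OF P]])

lemma app_add: "\<lbrakk>\<phi> \<in> carrier D; \<psi> \<in> carrier D; x \<in> carrier P\<rbrakk>
    \<Longrightarrow> app (\<phi> \<otimes>\<^bsub>D\<^esub> \<psi>) x = app \<phi> x \<otimes>\<^bsub>boole\<^esub> app \<psi> x"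
  unfolding dual_semimodule_def by (rule decode_fun_mult[OF P fin_semimod_boole])

lemma app_zero: "x \<in> carrier P \<Longrightarrow> app \<one>\<^bsub>D\<^esub> x = \<one>\<^bsub>boole\<^esub>"
  unfolding dual_semimodule_def by (rule decode_fun_one[OF P fin_semimod_boole])

lemmas app_closed = semimod_homD(1)[OF app_hom]

text \<open>Evaluation at a point is linear on \<open>D\<close>, so sums of functionals can be
  computed pointwise.\<close>

lemma app_at_hom: "x \<in> carrier P \<Longrightarrow> (\<lambda>\<phi>\<in>carrier D. app \<phi> x) \<in> semimod_hom D boole"
  by (rule semimod_homI) (simp_all add: app_closed app_add app_zero del: boole_simps(1,2))

lemma app_bilinear: "bilinear D P boole app"
  using P D
  by (intro bilinearI)
    (simp_all add: fin_semimodD app_closed app_add app_zero semimod_homD[OF app_hom]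
      del: boole_simps(1,2))

lemma coord_closed: "coord a \<in> carrier D"
  and app_coord: "x \<in> carrier P \<Longrightarrow> app (coord a) x = VBool (a \<in> s x)"
proof -
  have h: "(\<lambda>x\<in>carrier P. VBool (a \<in> s x)) \<in> semimod_hom P (boole :: 'a univ monoid)"
    by (rule semimod_homI) (auto simp: basisD)
  then show "coord a \<in> carrier D"
    by (simp add: coord_def dual_semimodule_def carrier_hom_semimodule)
  show "x \<in> carrier P \<Longrightarrow> app (coord a) x = VBool (a \<in> s x)"
    using h by (simp add: coord_def decode_code_fun fin_semimodD[OF P])
qed

text \<open>The coordinate map of \<open>D\<close>: the coefficient of \<phi> at
  \<open>coord a\<close> is its value at \<open>e a\<close>.\<close>

definition expand :: "'a univ \<Rightarrow> 'b set" where
  "expand = (\<lambda>\<phi>\<in>carrier D. {a \<in> A. app \<phi> (e a) = VBool True})"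

text \<open>At \<open>x\<close>, expanding \<open>x\<close> turns the value of \<phi> into the
  disjunction of \<phi>(e a) over \<open>a\<close> in \<open>s x\<close>. The sum of coordinates
  gives the disjunction of \<open>a \<in> s x\<close> over those \<open>a\<close> with \<phi>(e a) =
  1. Both say that the two index sets meet.\<close>

lemma finprod_coord:
  assumes \<phi>: "\<phi> \<in> carrier D"
  shows "finprod D coord {a \<in> A. app \<phi> (e a) = VBool True} = \<phi>"
proof -
  let ?B = "{a \<in> A. app \<phi> (e a) = VBool True}"
  have coords: "coord \<in> B \<rightarrow> carrier D" for B using coord_closed by blast
  have fin: "finite ?B" using basisD(1) by simp
  have "app (finprod D coord ?B) x = app \<phi> x" if x: "x \<in> carrier P" for x
  proof -
    note sx = basisD(3)[OF x] finite_subset[OF basisD(3)[OF x] basisD(1)]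
    have val: "app \<phi> (e a) = VBool (app \<phi> (e a) = VBool True)" if "a \<in> A" for a
      using app_closed[OF \<phi> basisD(2)[OF that]] by auto
    have "app (finprod D coord ?B) x = (\<lambda>\<psi>\<in>carrier D. app \<psi> x) (finprod D coord ?B)"
      using coords by simp
    also have "\<dots> = finprod boole (\<lambda>a. (\<lambda>\<psi>\<in>carrier D. app \<psi> x) (coord a)) ?B"
      by (rule semimod_hom_finprod[OF D.boolean_semimodule_axioms fin_semimodD(1)[OF fin_semimod_boole]
            app_at_hom[OF x] fin coords])
    also have "\<dots> = finprod boole (\<lambda>a. VBool (a \<in> s x)) ?B"
      using x by (simp add: coord_closed app_coord)
    \<comment> \<open>Here the roles are exchanged: membership in \<open>s x\<close>, tested on
      \<open>?B\<close>, becomes the value of \<phi>, tested on \<open>s x\<close>, which lies in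
      \<open>A\<close>.\<close>
    also have "\<dots> = VBool (\<exists>a\<in>s x. app \<phi> (e a) = VBool True)"
      unfolding finprod_boole[OF fin] using sx by auto
    also have "\<dots> = finprod boole (\<lambda>a. VBool (app \<phi> (e a) = VBool True)) (s x)"
      by (rule finprod_boole[OF sx(2), symmetric])
    also have "\<dots> = finprod boole (\<lambda>a. app \<phi> (e a)) (s x)"
      using sx val
      by (intro comm_monoid.finprod_cong'[OF fin_semimodD(2)[OF fin_semimod_boole]])
        (auto intro!: app_closed[OF \<phi>] basisD(2) simp del: boole_simps(1))
    also have "\<dots> = app \<phi> (finprod P e (s x))"
      using sx basisD(2)
      by (intro semimod_hom_finprod[symmetric] P.boolean_semimodule_axioms
          fin_semimodD(1)[OF fin_semimod_boole] app_hom \<phi>) auto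
    finally show ?thesis by (simp add: basisD(6)[OF x])
  qed
  then show ?thesis
    using fin_semimodD(4)[OF P] \<phi> coords D.finprod_closed[OF coords]
    unfolding dual_semimodule_def by (blast intro: hom_semimodule_eqI)
qed

lemma projective_dual: "projective D"
proof (rule dual_basis_imp_projective[OF D.boolean_semimodule_axioms])
  have or: "u \<otimes>\<^bsub>boole\<^esub> v = VBool True \<longleftrightarrow> u = VBool True \<or> v = VBool True" for u v :: "'a univ"
    by (simp add: boole_def)
  have "expand \<in> semimod_hom D (powerset_semimodule A)"
    by (rule semimod_homI)
      (auto simp: expand_def app_add app_zero basisD(2) or)
  then show "dual_basis D A coord expand"
    using basisD(1) coord_closed by (auto simp: dual_basis_def expand_def finprod_coord)
qed

text \<open>The canonical element: it corresponds to the identity of \<open>P\<close> under the map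
  to the endomorphisms of \<open>P\<close> that sends the pure tensor of y and \<phi> to the
  function mapping x to \<phi>(x) y.\<close>

definition coev_elem :: "'a univ" where
  "coev_elem = finprod (tensor P D) (\<lambda>a. pure_tensor P D (e a) (coord a)) A"

definition coevaluation :: "'a semimod_arrow" where
  "coevaluation = Arrow boole (tensor P D)
     (\<lambda>b\<in>carrier boole. if b = VBool True then coev_elem else \<one>\<^bsub>tensor P D\<^esub>)"

lemma evaluation_pure: "\<lbrakk>\<phi> \<in> carrier D; x \<in> carrier P\<rbrakk>
    \<Longrightarrow> fun_of (evaluation P) (pure_tensor D P \<phi> x) = app \<phi> x"
  unfolding evaluation_def
  by (simp add: tensor_lift_pure'[OF D P fin_semimodD(1)[OF fin_semimod_boole] app_bilinear])

lemma evaluation_hom: "fun_of (evaluation P) \<in> semimod_hom (tensor D P) boole"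
  unfolding evaluation_def
  by (simp add: tensor_lift_hom'[OF D P fin_semimodD(1)[OF fin_semimod_boole] app_bilinear])

lemma terms_closed: "(\<lambda>a. pure_tensor P D (e a) (coord a)) \<in> A \<rightarrow> carrier (tensor P D)"
  using P D basisD(2) coord_closed by auto

lemma tensor_PD: "boolean_semimodule (tensor P D)"
  by (rule fin_semimodD(1)[OF fin_semimod_tensor[OF P D]])

lemma coev_elem_closed: "coev_elem \<in> carrier (tensor P D)"
proof -
  interpret T: boolean_semimodule "tensor P D" by (rule tensor_PD)
  show ?thesis unfolding coev_elem_def by (rule T.finprod_closed[OF terms_closed])
qed

lemma coevaluation_hom: "fun_of coevaluation \<in> semimod_hom boole (tensor P D)"
proof -
  interpret T: boolean_semimodule "tensor P D" by (rule tensor_PD)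
  \<comment> \<open>Additivity at 1 + 1 = 1 asks that the image of 1 be idempotent.\<close>
  show ?thesis
    unfolding coevaluation_def using coev_elem_closed
    by (intro semimod_homI) (auto simp: T.idem)
qed

text \<open>In each zigzag the maps that follow the coevaluation are linear in the element of
  \<open>tensor P D\<close>, so they may be applied term by term.\<close>

lemma hom_coev_elem:
  assumes "F \<in> semimod_hom (tensor P D) K" "boolean_semimodule K"
  shows "F coev_elem = finprod K (\<lambda>a. F (pure_tensor P D (e a) (coord a))) A"
  unfolding coev_elem_def
  by (rule semimod_hom_finprod[OF tensor_PD assms(2,1) basisD(1) terms_closed])

section \<open>The zigzag identities\<close>

lemma lunit_map_pure_boole:
  "\<lbrakk>b \<in> carrier boole; fin_semimod M; x \<in> carrier M\<rbrakk>
    \<Longrightarrow> lunit_map M (pure_tensor boole M b x) = (if b = VBool True then x else \<one>\<^bsub>M\<^esub>)"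
  by (auto simp: lunit_map_pure split: if_splits)

text \<open>The coevaluation turns \<open>x\<close> into the sum of all \<open>e a\<close>,
  \<open>coord a\<close>, \<open>x\<close> tensored together; evaluating the last two factors leaves
  the sum of those \<open>e a\<close> with \<open>a \<in> s x\<close>, which is
  \<open>x\<close>.\<close>

lemma zigzag:
  "compose (carrier P)
     (compose (carrier (tensor boole P))
       (compose (carrier (tensor (tensor P D) P))
         (compose (carrier (tensor P (tensor D P))) (runit_map P)
           (tensor_map P (tensor D P) P boole (\<lambda>x\<in>carrier P. x) (fun_of (evaluation P))))
         (assoc_map P D P))
       (tensor_map boole P (tensor P D) P (fun_of coevaluation) (\<lambda>x\<in>carrier P. x)))
     (\<lambda>x\<in>carrier P. pure_tensor boole P (VBool True) x) = (\<lambda>x\<in>carrier P. x)"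
  (is "compose _ (compose _ ?F _) _ = _")
proof (rule extensionalityI[of _ "carrier P"])
  fix x assume x: "x \<in> carrier P"
  note fin = P D fin_semimod_boole fin_semimod_tensor
  have F: "?F \<in> semimod_hom (tensor (tensor P D) P) P"
    by (rule structure_homs evaluation_hom fin P.monoid_axioms fin_semimodD(3))+
  \<comment> \<open>The other tensor factor is frozen at \<open>x\<close>, which leaves a
    homomorphism of the element of \<open>tensor P D\<close> alone.\<close>
  define G where "G = compose (carrier (tensor P D)) ?F
    (\<lambda>w\<in>carrier (tensor P D). pure_tensor (tensor P D) P w x)"
  have G: "G \<in> semimod_hom (tensor P D) P"
    unfolding G_def
    by (rule semimod_hom_compose[OF _ pure_tensor_hom_left F] fin x fin_semimodD(3))+
  have G_pure: "G (pure_tensor P D (e a) (coord a)) = (if a \<in> s x then e a else \<one>\<^bsub>P\<^esub>)"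
    if "a \<in> A" for a
    using that x P D unfolding G_def
    by (simp add: structure_pures fin_semimodD coord_closed basisD(2) evaluation_hom
        semimod_hom_id assoc_map_hom evaluation_pure app_coord)
  have "?F (pure_tensor (tensor P D) P coev_elem x) = G coev_elem"
    using coev_elem_closed by (simp add: G_def compose_eq)
  also have "\<dots> = finprod P (\<lambda>a. if a \<in> s x then e a else \<one>\<^bsub>P\<^esub>) A"
    unfolding hom_coev_elem[OF G P.boolean_semimodule_axioms]
    using G_pure basisD(2) by (intro P.finprod_cong') auto
  \<comment> \<open>Indices outside \<open>s x\<close> contribute zero and drop out.\<close>
  also have "\<dots> = finprod P e (s x)"
    using basisD(1,2) basisD(3)[OF x] by (intro P.finprod_mono_neutral_cong_right) auto
  also have "\<dots> = x" by (rule basisD(6)[OF x])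
  finally have "?F (pure_tensor (tensor P D) P coev_elem x) = x" .
  moreover have "fun_of coevaluation (VBool True) = coev_elem" by (simp add: coevaluation_def)
  ultimately show "compose (carrier P) (compose (carrier (tensor boole P)) ?F
      (tensor_map boole P (tensor P D) P (fun_of coevaluation) (\<lambda>x\<in>carrier P. x)))
     (\<lambda>x\<in>carrier P. pure_tensor boole P (VBool True) x) x = (\<lambda>x\<in>carrier P. x) x"
    using x P D
    by (simp add: compose_eq[of _ "carrier P"] compose_eq[of _ "carrier (tensor boole P)"]
        tensor_map_pure coevaluation_hom semimod_hom_id fin_semimodD)
qed auto

text \<open>With \<phi> on the left, the evaluation pairs it with \<open>e a\<close> and keeps
  \<open>coord a\<close> when \<phi>(e a) = 1. The remaining sum is the expansion in
  \<open>finprod_coord\<close>.\<close>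

lemma zigzag_dual:
  "compose (carrier D)
     (compose (carrier (tensor D boole))
       (compose (carrier (tensor D (tensor P D)))
         (compose (carrier (tensor (tensor D P) D)) (lunit_map D)
           (tensor_map (tensor D P) D boole D (fun_of (evaluation P)) (\<lambda>x\<in>carrier D. x)))
         (assoc_inv_map D P D))
       (tensor_map D boole D (tensor P D) (\<lambda>x\<in>carrier D. x) (fun_of coevaluation)))
     (\<lambda>x\<in>carrier D. pure_tensor D boole x (VBool True)) = (\<lambda>x\<in>carrier D. x)"
  (is "compose _ (compose _ ?F _) _ = _")
proof (rule extensionalityI[of _ "carrier D"])
  fix \<phi> assume \<phi>: "\<phi> \<in> carrier D"
  note fin = P D fin_semimod_boole fin_semimod_tensor
  have F: "?F \<in> semimod_hom (tensor D (tensor P D)) D"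
    by (rule structure_homs assoc_inv_map_hom evaluation_hom fin D.monoid_axioms fin_semimodD(3))+
  define G where "G = compose (carrier (tensor P D)) ?F
    (\<lambda>w\<in>carrier (tensor P D). pure_tensor D (tensor P D) \<phi> w)"
  have G: "G \<in> semimod_hom (tensor P D) D"
    unfolding G_def
    by (rule semimod_hom_compose[OF _ pure_tensor_hom_right F] fin \<phi> fin_semimodD(3))+
  have G_pure: "G (pure_tensor P D (e a) (coord a)) =
      (if app \<phi> (e a) = VBool True then coord a else \<one>\<^bsub>D\<^esub>)"
    if "a \<in> A" for a
    using that \<phi> P D unfolding G_def
    by (simp add: structure_pures assoc_inv_map_pure fin_semimodD coord_closed basisD(2)
        evaluation_hom semimod_hom_id assoc_inv_map_hom evaluation_pure
        lunit_map_pure_boole[OF app_closed])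
  have "?F (pure_tensor D (tensor P D) \<phi> coev_elem) = G coev_elem"
    using coev_elem_closed by (simp add: G_def compose_eq)
  also have "\<dots> = finprod D (\<lambda>a. if app \<phi> (e a) = VBool True then coord a else \<one>\<^bsub>D\<^esub>) A"
    unfolding hom_coev_elem[OF G D.boolean_semimodule_axioms]
    using G_pure coord_closed by (intro D.finprod_cong') auto
  also have "\<dots> = finprod D coord {a \<in> A. app \<phi> (e a) = VBool True}"
    using basisD(1) coord_closed by (intro D.finprod_mono_neutral_cong_right) auto
  also have "\<dots> = \<phi>" by (rule finprod_coord[OF \<phi>])
  finally have "?F (pure_tensor D (tensor P D) \<phi> coev_elem) = \<phi>" .
  moreover have "fun_of coevaluation (VBool True) = coev_elem" by (simp add: coevaluation_def)
  ultimately show "compose (carrier D) (compose (carrier (tensor D boole)) ?F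
      (tensor_map D boole D (tensor P D) (\<lambda>x\<in>carrier D. x) (fun_of coevaluation)))
     (\<lambda>x\<in>carrier D. pure_tensor D boole x (VBool True)) \<phi> = (\<lambda>x\<in>carrier D. x) \<phi>"
    using \<phi> P D
    by (simp add: compose_eq[of _ "carrier D"] compose_eq[of _ "carrier (tensor D boole)"]
        tensor_map_pure coevaluation_hom semimod_hom_id fin_semimodD)
qed auto

theorem is_dual_dual_semimodule:
  "is_dual finite_semimodules P D (evaluation P) coevaluation"
proof -
  let ?C = "finite_semimodules :: ('a univ monoid, 'a semimod_arrow) sym_monoidal"
  interpret category ?C by (rule category_finite_semimodules)
  note inv = inv_arrow_eqI[OF inverse_arrows_lunit[OF P]]
    inv_arrow_eqI[OF inverse_arrows_runit[OF D]]
    inv_arrow_eqI[OF inverse_arrows_assoc[OF D P D]]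
  have arrows: "evaluation P = Arrow (tensor D P) boole (fun_of (evaluation P))"
    "coevaluation = Arrow boole (tensor P D) (fun_of coevaluation)"
    by (simp_all add: evaluation_def coevaluation_def)
  \<comment> \<open>Writing both maps with the constructor \<open>Arrow\<close> exposes their
    sources and targets, so that the composites unfold to those of \<open>zigzag\<close> and
    \<open>zigzag_dual\<close>.\<close>
  show ?thesis
    unfolding is_dual_def inv
    by (subst (1 2 3) arrows(1), subst (1 2 3) arrows(2))
      (use zigzag zigzag_dual P D evaluation_hom coevaluation_hom in
        \<open>simp add: finite_semimodules_simps Homset_finite_semimodules\<close>)
qed

end

text \<open>Rigidity only asserts that some dual exists. The second conjunct fixes it to be Hom(P,
  B) with the evaluation pairing, and it yields the first once the monoidal structure is in
  place.\<close>

theorem proposition3p14: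
  shows "rigid_symmetric_monoidal_category
      (finite_projective_semimodules :: ('a univ monoid, 'a semimod_arrow) sym_monoidal) \<and>
    (\<forall>P \<in> Obj (finite_projective_semimodules :: ('a univ monoid, 'a semimod_arrow) sym_monoidal).
      \<exists>coev. is_dual finite_projective_semimodules P (dual_semimodule P) (evaluation P) coev)"
proof -
  let ?C = "finite_semimodules :: ('a univ monoid, 'a semimod_arrow) sym_monoidal"
  let ?P = "finite_projective_semimodules :: ('a univ monoid, 'a semimod_arrow) sym_monoidal"
  interpret C: symmetric_monoidal_category ?C
    by (rule symmetric_monoidal_category_finite_semimodules)
  have unit: "Unit ?C \<in> {P. projective P}"
    by (simp add: finite_semimodules_simps projective_boole)
  have ten: "X \<odot>\<^bsub>?C\<^esub> Y \<in> {P. projective P}"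
    if "X \<in> Obj ?C" "Y \<in> Obj ?C" "X \<in> {P. projective P}" "Y \<in> {P. projective P}" for X Y
    using that by (simp add: finite_semimodules_simps projective_tensor)
  interpret P: symmetric_monoidal_category ?P
    unfolding finite_projective_semimodules_def by (rule C.full_monoidal_subcategory[OF unit ten])
  have dual: "\<exists>coev. is_dual ?P P (dual_semimodule P) (evaluation P) coev" if "P \<in> Obj ?P" for P
  proof -
    have proj: "fin_semimod P" "projective P"
      using that by (simp_all add: finite_projective_semimodules_def finite_semimodules_simps)
    obtain s where "dual_basis P (carrier P) (\<lambda>x. x) s"
      using projective_imp_dual_basis proj fin_semimodD(4) by blast
    with proj(1) interpret projective_with_dual_basis P "carrier P" "\<lambda>x. x" s
      by unfold_locales
    have "is_dual ?P P (dual_semimodule P) (evaluation P) coevaluation"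
      unfolding finite_projective_semimodules_def
      by (rule C.is_dual_full_subcategory[OF is_dual_dual_semimodule])
        (use proj projective_dual unit ten in auto)
    then show ?thesis by blast
  qed
  then have "rigid_symmetric_monoidal_category ?P"
    by unfold_locales blast
  with dual show ?thesis by blast
qed

end
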